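(* Let $(\psi,\mathcal X,\mathcal Y,\mathcal U,\mathcal P,\|\cdot\|,r)$ be a dual-extraction setup (defined in the context), let $y_0\in\mathcal Y\cap\operatorname{int}\mathcal P$, and let $y^\star\in\operatorname{argmax}_{y\in\mathcal Y}\phi(y)$. Suppose $\phi$ is $L$-Lipschitz with respect to $\|\cdot\|$, and let $B>0$ be such that $V_{y_0}(y^\star)\le B$. Then for any $\epsilon>0$ and any integer $K\ge\max\left\{\log_2\frac{L^2B}{\mu_r\epsilon^2},1\right\}+10$, the output $y_K$ of the dual-extraction framework (defined in the context) started at $y_0$ with $$\lambda_k=2^k\frac{\epsilon}{4B}\ \text{ for }k\in\{0,1,\dots,K-1\}\qquad\text{and}\qquad\epsilon_k=\frac{\epsilon}{4K}\ \text{ for }k\in\{1,\dots,K\}$$ satisfies $\phi(y^\star)-\mathbb E\,\phi(y_K)\le\epsilon$.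
   Context: Dgf setup. $(\mathcal U,\mathcal P,\|\cdot\|,r)$ is a dgf setup over $\mathbb R^n$ if $\mathcal U\subseteq\mathcal P\subseteq\mathbb R^n$ are closed convex sets with $\mathcal U\cap\operatorname{int}\mathcal P\ne\emptyset$, $\|\cdot\|$ is a norm on $\mathbb R^n$, and: (i) $r:\mathcal P\to\mathbb R$ is convex and continuous on $\mathcal P$, differentiable on $\operatorname{int}\mathcal P$, and $\mu_r$-strongly convex with respect to $\|\cdot\|$ on $\mathcal U\cap\operatorname{int}\mathcal P$ for some $\mu_r>0$; (ii) either $\lim_{u\to\operatorname{bd}\mathcal P}\|\nabla r(u)\|_2=\infty$ or $\mathcal U\subseteq\operatorname{int}\mathcal P$. Its Bregman divergence is $V_u(v):=r(v)-r(u)-\langle\nabla r(u),v-u\rangle$ for $u\in\operatorname{int}\mathcal P$, $v\in\mathcal P$. Dual-extraction setup. A tuple $(\psi,\mathcal X,\mathcal Y,\mathcal U,\mathcal P,\|\cdot\|,r)$ with $\psi:\mathbb R^d\times\mathbb R^n\to\mathbb R$ such that: (i) $\psi(x,\cdot)$ is differentiable for every $x$; (ii) $\psi(\cdot,y)$ is convex for every $y$ and $\psi(x,\cdot)$ is concave for every $x$; (iii) $(\mathcal U,\mathcal P,\|\cdot\|,r)$ is a dgf setup over $\mathbb R^n$; (iv) $\mathcal X\subseteq\mathbb R^d$ and $\mathcal Y\subseteq\mathbb R^n$ are nonempty, closed, convex, with $\mathcal Y\subseteq\mathcal U$ and $\mathcal Y\cap\operatorname{int}\mathcal P\neq\emptyset$;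 (v) $\mathcal X$ is bounded or $\psi(\cdot,y)$ is strongly convex for every $y$; (vi) $\mathcal Y$ is bounded or $\psi(x,\cdot)$ is strongly concave for every $x$; (vii) for all $p\in\mathcal U\cap\operatorname{int}\mathcal P$ and all $w\in\partial\mathbb I_{\mathcal U}(p)$ (with $\mathbb I_{\mathcal U}$ the $0/\infty$ indicator of $\mathcal U$), the map $y\mapsto\langle w,y\rangle$ is constant over $\mathcal Y$. Notation. $\phi(y):=\min_{x\in\mathcal X}\psi(x,y)$ on $\mathcal Y$; for $\lambda>0$ and $q\in\mathcal U\cap\operatorname{int}\mathcal P$, $f_{\lambda,q}(x):=\max_{y\in\mathcal Y}\{\psi(x,y)-\lambda V_q(y)\}$ on $\mathcal X$. Oracles. $\mathrm{DRPO}(q,\lambda,\epsilon_{\mathrm p})$ returns a (possibly random) $x\in\mathcal X$ with $\mathbb E f_{\lambda,q}(x)\le\inf_{x'\in\mathcal X}f_{\lambda,q}(x')+\epsilon_{\mathrm p}$, the expectation being over the oracle's internal randomness. $\mathrm{DRBR}(q,\lambda,x)$ returns $\operatorname{argmax}_{y\in\mathcal Y}\{\psi(x,y)-\lambda V_q(y)\}$. Dual-extraction framework. Inputs: $y_0$, $K$, $(\lambda_k)_{k=0}^{K-1}$, $(\epsilon_k)_{k=1}^K$. For $k=1,\dots,K$: set $\Lambda_k=\sum_{j=0}^{k-1}\lambda_j$; $q_k=\operatorname{argmin}_{q\in\mathcal U}\frac1{\Lambda_k}\sum_{j=0}^{k-1}\lambda_jV_{y_j}(q)$; $x_k=\mathrm{DRPO}(q_k,\Lambda_k,\epsilon_k)$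 (the oracle guarantee holds conditionally on the previously generated iterates); $y_k=\mathrm{DRBR}(q_k,\Lambda_k,x_k)$. Return $y_K$. Expectations are over the randomness of all DRPO calls. *)

theory Defs
  imports "HOL-Probability.Probability"
begin

definition is_norm :: "('a::real_vector \<Rightarrow> real) \<Rightarrow> bool" where
  "is_norm N \<longleftrightarrow>
     (\<forall>u. 0 \<le> N u) \<and> (\<forall>u. N u = 0 \<longleftrightarrow> u = 0) \<and>
     (\<forall>c u. N (c *\<^sub>R u) = \<bar>c\<bar> * N u) \<and>
     (\<forall>u v. N (u + v) \<le> N u + N v)"

definition strongly_convex_on ::
  "real \<Rightarrow> ('a::real_vector \<Rightarrow> real) \<Rightarrow> 'a set \<Rightarrow> ('a \<Rightarrow> real) \<Rightarrow> bool" where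
  "strongly_convex_on \<mu> N S f \<longleftrightarrow>
     convex S \<and>
     (\<forall>u\<in>S. \<forall>v\<in>S. \<forall>t\<in>{0..1}.
        f (t *\<^sub>R u + (1 - t) *\<^sub>R v) \<le>
          t * f u + (1 - t) * f v - \<mu> / 2 * t * (1 - t) * (N (u - v))\<^sup>2)"

text \<open>Only meaningful at points where \<open>f\<close> is differentiable.\<close>

definition grad :: "('a::real_inner \<Rightarrow> real) \<Rightarrow> 'a \<Rightarrow> 'a" where
  "grad f u = (THE D. GDERIV f u :> D)"

definition bregman :: "('a::real_inner \<Rightarrow> real) \<Rightarrow> 'a \<Rightarrow> 'a \<Rightarrow> real" where
  "bregman r u v = r v - r u - grad r u \<bullet> (v - u)"

definition indicator_ext :: "'a set \<Rightarrow> 'a \<Rightarrow> ereal" where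
  "indicator_ext U u = (if u \<in> U then 0 else \<infinity>)"

definition subdifferential :: "('a::real_inner \<Rightarrow> ereal) \<Rightarrow> 'a \<Rightarrow> 'a set" where
  "subdifferential g p = {w. \<forall>u. g p + ereal (w \<bullet> (u - p)) \<le> g u}"

text \<open>The function \<open>r\<close> is total, but only its values on \<open>P\<close> matter.  In the last conjunct,
  divergence of the gradient at the boundary is required at each boundary point separately
  (approached from the interior); it holds vacuously if \<open>P\<close> is the whole space.\<close>

definition dgf_setup ::
  "(real^'n) set \<Rightarrow> (real^'n) set \<Rightarrow> (real^'n \<Rightarrow> real) \<Rightarrow> (real^'n \<Rightarrow> real) \<Rightarrow> real \<Rightarrow> bool" where
  "dgf_setup U P N r \<mu> \<longleftrightarrow>
     closed U \<and> convex U \<and> closed P \<and> convex P \<and> U \<subseteq> P \<and> U \<inter> interior P \<noteq> {} \<and>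
     is_norm N \<and>
     convex_on P r \<and> continuous_on P r \<and>
     (\<forall>u\<in>interior P. r differentiable (at u)) \<and>
     \<mu> > 0 \<and> strongly_convex_on \<mu> N (U \<inter> interior P) r \<and>
     ((\<forall>z\<in>frontier P. filterlim (\<lambda>u. norm (grad r u)) at_top (at z within interior P)) \<or>
      U \<subseteq> interior P)"

text \<open>Strong convexity or concavity of \<open>\<psi>\<close> in one argument refers to the Euclidean norm, and the
  modulus may depend on the other argument.\<close>

definition dual_extraction_setup ::
  "(real^'d \<Rightarrow> real^'n \<Rightarrow> real) \<Rightarrow> (real^'d) set \<Rightarrow> (real^'n) set \<Rightarrow>
   (real^'n) set \<Rightarrow> (real^'n) set \<Rightarrow> (real^'n \<Rightarrow> real) \<Rightarrow> (real^'n \<Rightarrow> real) \<Rightarrow> real \<Rightarrow> bool" where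
  "dual_extraction_setup \<psi> X Y U P N r \<mu> \<longleftrightarrow>
     (\<forall>x y. (\<lambda>y'. \<psi> x y') differentiable (at y)) \<and>
     (\<forall>y. convex_on UNIV (\<lambda>x. \<psi> x y)) \<and> (\<forall>x. concave_on UNIV (\<lambda>y. \<psi> x y)) \<and>
     dgf_setup U P N r \<mu> \<and>
     X \<noteq> {} \<and> closed X \<and> convex X \<and> Y \<noteq> {} \<and> closed Y \<and> convex Y \<and>
     Y \<subseteq> U \<and> Y \<inter> interior P \<noteq> {} \<and>
     (bounded X \<or> (\<forall>y. \<exists>m>0. strongly_convex_on m norm UNIV (\<lambda>x. \<psi> x y))) \<and>
     (bounded Y \<or> (\<forall>x. \<exists>m>0. strongly_convex_on m norm UNIV (\<lambda>y. - \<psi> x y))) \<and>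
     (\<forall>p\<in>U \<inter> interior P. \<forall>w\<in>subdifferential (indicator_ext U) p.
        (\<lambda>y. w \<bullet> y) constant_on Y)"

text \<open>Under the setup assumptions the infimum (for \<open>y \<in> Y\<close>) and the supremum (for \<open>lam > 0\<close>,
  \<open>q \<in> U \<inter> interior P\<close>) below are attained.\<close>

definition primal_min :: "('x \<Rightarrow> 'y \<Rightarrow> real) \<Rightarrow> 'x set \<Rightarrow> 'y \<Rightarrow> real" where
  "primal_min \<psi> X y = (INF x\<in>X. \<psi> x y)"

definition dual_reg ::
  "('x \<Rightarrow> 'y::real_inner \<Rightarrow> real) \<Rightarrow> 'y set \<Rightarrow> ('y \<Rightarrow> real) \<Rightarrow> real \<Rightarrow> 'y \<Rightarrow> 'x \<Rightarrow> real" where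
  "dual_reg \<psi> Y r lam q x = (SUP y\<in>Y. \<psi> x y - lam * bregman r q y)"

text \<open>The sigma-algebra generated by the previous oracle outputs \<open>x 1, \<dots>, x (k - 1)\<close>.  All other
  iterates \<open>y j\<close> (\<open>j < k\<close>) and \<open>q j\<close> (\<open>j \<le> k\<close>) are functions of these outputs.\<close>

definition past :: "'w measure \<Rightarrow> (nat \<Rightarrow> 'w \<Rightarrow> 'x::topological_space) \<Rightarrow> nat \<Rightarrow> 'w measure" where
  "past M x k = sigma (space M) (\<Union>j\<in>{1..<k}. {x j -` A \<inter> space M | A. A \<in> sets borel})"

text \<open>A random point \<open>x\<close> returned by DRPO when called with the (random) centre \<open>q\<close>, where \<open>F\<close> is
  the information available before the call.  The condition
  E[f(x) | F] \<open>\<le>\<close> inf f + \<open>\<epsilon>\<close>, with f = \<open>dual_reg \<psi> Y r lam q\<close> known given \<open>F\<close>, is written as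
  E[f(x) - inf f | F] \<open>\<le>\<close> \<open>\<epsilon>\<close>.  The argument is nonnegative because \<open>x\<close> is in \<open>X\<close>, so that
  this conditional expectation exists in \<open>[0, \<infinity>]\<close> without any integrability assumption.\<close>

definition DRPO_output ::
  "('x::topological_space \<Rightarrow> 'y::real_inner \<Rightarrow> real) \<Rightarrow> 'x set \<Rightarrow> 'y set \<Rightarrow> ('y \<Rightarrow> real) \<Rightarrow>
   'w measure \<Rightarrow> 'w measure \<Rightarrow> ('w \<Rightarrow> 'y) \<Rightarrow> real \<Rightarrow> real \<Rightarrow> ('w \<Rightarrow> 'x) \<Rightarrow> bool" where
  "DRPO_output \<psi> X Y r M F q lam \<epsilon> x \<longleftrightarrow>
     x \<in> borel_measurable M \<and> (\<forall>\<omega>\<in>space M. x \<omega> \<in> X) \<and>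
     (AE \<omega> in M.
        nn_cond_exp M F
          (\<lambda>\<omega>. ennreal (dual_reg \<psi> Y r lam (q \<omega>) (x \<omega>) - (INF x'\<in>X. dual_reg \<psi> Y r lam (q \<omega>) x'))) \<omega>
        \<le> ennreal \<epsilon>)"

text \<open>The processes \<open>x\<close>, \<open>q\<close>, \<open>y\<close> on \<open>M\<close> form a run of the framework with \<open>K\<close> iterations,
  weights \<open>l 0, \<dots>, l (K - 1)\<close> and accuracies \<open>e 1, \<dots>, e K\<close>; the output is \<open>y K\<close>.\<close>

definition dual_extraction_run ::
  "(real^'d \<Rightarrow> real^'n \<Rightarrow> real) \<Rightarrow> (real^'d) set \<Rightarrow> (real^'n) set \<Rightarrow> (real^'n) set \<Rightarrow>
   (real^'n \<Rightarrow> real) \<Rightarrow> real^'n \<Rightarrow> nat \<Rightarrow> (nat \<Rightarrow> real) \<Rightarrow> (nat \<Rightarrow> real) \<Rightarrow>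
   'w measure \<Rightarrow> (nat \<Rightarrow> 'w \<Rightarrow> real^'d) \<Rightarrow> (nat \<Rightarrow> 'w \<Rightarrow> real^'n) \<Rightarrow> (nat \<Rightarrow> 'w \<Rightarrow> real^'n) \<Rightarrow> bool"
  where
  "dual_extraction_run \<psi> X Y U r y0 K l e M x q y \<longleftrightarrow>
     prob_space M \<and>
     (\<forall>\<omega>\<in>space M. y 0 \<omega> = y0) \<and>
     (\<forall>k\<in>{1..K}.
        (\<forall>\<omega>\<in>space M.
           is_arg_min (\<lambda>v. 1 / (\<Sum>j<k. l j) * (\<Sum>j<k. l j * bregman r (y j \<omega>) v))
             (\<lambda>v. v \<in> U) (q k \<omega>)) \<and>
        DRPO_output \<psi> X Y r M (past M x k) (q k) (\<Sum>j<k. l j) (e k) (x k) \<and>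
        (\<forall>\<omega>\<in>space M.
           is_arg_max (\<lambda>v. \<psi> (x k \<omega>) v - (\<Sum>j<k. l j) * bregman r (q k \<omega>) v)
             (\<lambda>v. v \<in> Y) (y k \<omega>)))"

end

theory Submission
  imports Defs
begin

text \<open>
  Write \<open>\<Lambda>\<^sub>k = \<Sum>j<k. l j\<close>, let \<open>V\<close> be the Bregman divergence of \<open>r\<close> and \<open>\<phi>\<close> the function
  \<open>primal_min \<psi> X\<close>, and let \<open>z\<^sub>k\<close> maximize the regularized dual objective
  \<open>\<phi>\<^sub>k v = \<phi> v - (\<Sum>j<k. l j * V\<^bsub>y j\<^esub> v)\<close> over \<open>Y\<close>.  The points \<open>z\<^sub>k\<close> are never computed, but
  they link the iterates to a maximizer of \<open>\<phi>\<close>.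

  The assumption that normal vectors of \<open>U\<close> are constant on \<open>Y\<close> makes \<open>\<Lambda>\<^sub>k * V\<^bsub>q k\<^esub>\<close> and
  \<open>\<Sum>j<k. l j * V\<^bsub>y j\<^esub>\<close> differ by a constant on \<open>Y\<close> (\<open>bregman_center_shift\<close>).  The proximal call
  number \<open>k\<close> therefore approximately minimizes over \<open>x\<close> the maximum over \<open>v\<close> of
  \<open>F x v = \<psi> x v - (\<Sum>j<k. l j * V\<^bsub>y j\<^esub> v)\<close>, and \<open>y k\<close> is the best response to \<open>x k\<close> in the same
  game.  By minimax duality (\<open>saddle_point_exists\<close>) the value of this game is \<open>\<phi>\<^sub>k z\<^sub>k\<close>, and
  \<open>F x z\<^sub>k\<close> is at least that value for every \<open>x \<in> X\<close>.  The three-point inequality for best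
  responses says \<open>F (x k) z\<^sub>k + \<Lambda>\<^sub>k * V\<^bsub>y k\<^esub> z\<^sub>k \<le> F (x k) (y k)\<close>.  Together,
  \<open>\<Lambda>\<^sub>k * V\<^bsub>y k\<^esub> z\<^sub>k\<close> is at most the primal gap of \<open>x k\<close> (\<open>bregman_opt_le_gap\<close>), whose mean is
  at most \<open>e k\<close>.

  Passing from \<open>\<phi>\<^sub>k\<close> to \<open>\<phi>\<^bsub>k+1\<^esub>\<close> lowers the maximum by at most \<open>l k * V\<^bsub>y k\<^esub> z\<^sub>k\<close>, which is
  at most \<open>l k / \<Lambda>\<^sub>k\<close> times that gap.  Summing up, \<open>\<phi> z\<^sub>K\<close> falls short of the maximum of \<open>\<phi>\<close> by at
  most \<open>l 0 * V\<^bsub>y0\<^esub> ystar + (\<Sum>k=1..<K. l k / \<Lambda>\<^sub>k * e k)\<close> in the mean.  Finally \<open>\<phi> (y K)\<close> and \<open>\<phi> z\<^sub>K\<close>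
  differ by at most \<open>L * N (z\<^sub>K - y K)\<close>, and by strong convexity \<open>N (z\<^sub>K - y K)\<^sup>2\<close> has mean at most
  \<open>2 * e K / (\<mu> * \<Lambda>\<^sub>K)\<close>.  When the weights double in each round, \<open>l k / \<Lambda>\<^sub>k \<le> 2\<close> while \<open>\<Lambda>\<^sub>K\<close> grows like
  \<open>2 ^ K\<close>: the sum is at most \<open>\<epsilon> / 2\<close>, and \<open>K\<close> of order \<open>log 2 (L\<^sup>2 * B / (\<mu> * \<epsilon>\<^sup>2))\<close> makes the
  last term small.

  Two further points need care.  Gradients, and hence the divergences \<open>V\<^bsub>y k\<^esub>\<close>, only make sense
  in the interior of \<open>P\<close>; the boundary behaviour of \<open>grad r\<close> keeps all iterates there
  (\<open>regularized_maximizer_interior\<close>).  The iterates must moreover be measurable: the conditional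
  expectation in the accuracy guarantee is set to \<open>0\<close> for a nonmeasurable gap, so that the
  guarantee would be empty.  All data of round \<open>k\<close> depend on the past only through the vector
  \<open>g = (\<Sum>j<k. l j *\<^sub>R grad r (y j))\<close>.  The inner maximum is a finite convex function of \<open>(g, x)\<close>, hence
  continuous; its minimum over \<open>x \<in> X\<close> is a finite convex function of \<open>g\<close>; and the best response
  is the gradient of the inner maximum in \<open>g\<close>, a limit of difference quotients.
\<close>

section \<open>Coercive minimization and one-sided slopes\<close>

lemma continuous_attains_inf_coercive:
  fixes f :: "'a::euclidean_space \<Rightarrow> real"
  assumes S: "closed S" "S \<noteq> {}" "continuous_on S f"
    and coercive: "bounded S \<or> (\<exists>a>0. \<exists>c. \<forall>v\<in>S. a * (norm v)\<^sup>2 - c \<le> f v)"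
  obtains v where "v \<in> S" "\<And>w. w \<in> S \<Longrightarrow> f v \<le> f w"
proof -
  obtain v0 where v0: "v0 \<in> S"
    using S by auto
  define T where "T = {v \<in> S. f v \<le> f v0}"
  have "closed T"
    unfolding T_def by (intro continuous_on_closed_Collect_le S continuous_intros)
  moreover have "bounded T"
    using coercive
  proof (elim disjE exE conjE)
    assume "bounded S"
    then show ?thesis
      by (rule bounded_subset) (auto simp: T_def)
  next
    fix a c :: real assume a: "0 < a" and c: "\<forall>v\<in>S. a * (norm v)\<^sup>2 - c \<le> f v"
    have "norm v \<le> sqrt ((f v0 + c) / a)" if "v \<in> T" for v
    proof (rule real_le_rsqrt)
      have "a * (norm v)\<^sup>2 \<le> f v0 + c"
        using c that by (force simp: T_def)
      then show "(norm v)\<^sup>2 \<le> (f v0 + c) / a"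
        using a by (simp add: field_simps)
    qed
    then show ?thesis
      by (auto simp: bounded_iff)
  qed
  ultimately have "compact T"
    by (simp add: compact_eq_bounded_closed)
  moreover have "T \<noteq> {}" "continuous_on T f"
    using v0 S by (auto simp: T_def intro: continuous_on_subset)
  ultimately obtain v where v: "v \<in> T" "\<And>w. w \<in> T \<Longrightarrow> f v \<le> f w"
    using continuous_attains_inf by metis
  have "f v \<le> f w" if "w \<in> S" for w
    using v that by (cases "w \<in> T") (auto simp: T_def)
  with v show thesis
    by (intro that[of v]) (auto simp: T_def)
qed

text \<open>Outside the unit ball, strong convexity on the segment from \<open>0\<close> to \<open>v\<close> bounds \<open>f v\<close> below by
  \<open>m / 2 * (s\<^sup>2 - s)\<close> plus a multiple of \<open>s = norm v\<close>, because that segment meets the unit sphere,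
  where \<open>f\<close> is bounded.  Half of the quadratic term absorbs everything linear in \<open>s\<close>.\<close>

lemma strongly_convex_quadratic_minorant:
  fixes f :: "'a::euclidean_space \<Rightarrow> real"
  assumes sc: "strongly_convex_on m norm UNIV f" and m: "m > 0" and cont: "continuous_on UNIV f"
  obtains c where "\<And>v. m / 4 * (norm v)\<^sup>2 - c \<le> f v"
proof -
  have "compact (cball (0::'a) 1)" "continuous_on (cball 0 1) f"
    using cont by (auto intro: continuous_on_subset)
  then obtain z where z: "\<And>v. v \<in> cball 0 1 \<Longrightarrow> f z \<le> f v"
    using continuous_attains_inf[of "cball (0::'a) 1" f] by force
  define D where "D = \<bar>f z\<bar> + \<bar>f 0\<bar> + m / 2"
  have D: "D \<ge> 0" using m by (simp add: D_def)
  show thesis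
  proof (rule that)
    fix v :: 'a
    define s where "s = norm v"
    show "m / 4 * (norm v)\<^sup>2 - (D\<^sup>2 / m + \<bar>f z\<bar> + m / 4) \<le> f v"
    proof (cases "s \<le> 1")
      case True
      have "s\<^sup>2 \<le> 1"
        using True by (simp add: s_def abs_square_le_1)
      then have "m / 4 * s\<^sup>2 \<le> m / 4"
        using m by (simp add: mult_left_le)
      moreover have "f z \<le> f v"
        using z True by (simp add: s_def)
      moreover have "D\<^sup>2 / m \<ge> 0" using m by simp
      ultimately show ?thesis by (simp add: s_def)
    next
      case False
      then have "1 / s \<in> {0..1}"
        by (simp add: divide_simps)
      have "f ((1 / s) *\<^sub>R v + (1 - 1 / s) *\<^sub>R 0) \<le>
          1 / s * f v + (1 - 1 / s) * f 0 - m / 2 * (1 / s) * (1 - 1 / s) * (norm (v - 0))\<^sup>2"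
        using sc \<open>1 / s \<in> {0..1}\<close> unfolding strongly_convex_on_def by blast
      moreover have "f z \<le> f ((1 / s) *\<^sub>R v + (1 - 1 / s) *\<^sub>R 0)"
        using False by (intro z) (simp add: s_def)
      ultimately have "f z \<le>
          1 / s * f v + (1 - 1 / s) * f 0 - m / 2 * (1 / s) * (1 - 1 / s) * s\<^sup>2"
        by (simp add: s_def)
      then have "s * f z \<le>
          s * (1 / s * f v + (1 - 1 / s) * f 0 - m / 2 * (1 / s) * (1 - 1 / s) * s\<^sup>2)"
        using False by (intro mult_left_mono) auto
      also have "\<dots> = f v + (s - 1) * f 0 - m / 2 * (s\<^sup>2 - s)"
        using False by (simp add: field_simps power2_eq_square)
      finally have "m / 2 * s\<^sup>2 \<le> f v + (s - 1) * f 0 + s * (m / 2) - s * f z"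
        by (simp add: algebra_simps)
      moreover have "(s - 1) * f 0 \<le> s * \<bar>f 0\<bar>"
      proof -
        have "(s - 1) * f 0 \<le> (s - 1) * \<bar>f 0\<bar>"
          using False by (intro mult_left_mono) auto
        also have "\<dots> \<le> s * \<bar>f 0\<bar>"
          by (intro mult_right_mono) auto
        finally show ?thesis .
      qed
      moreover have "- (s * f z) \<le> s * \<bar>f z\<bar>"
        using mult_left_mono[of "- f z" "\<bar>f z\<bar>" s] False by auto
      ultimately have "m / 2 * s\<^sup>2 \<le> f v + s * D"
        by (simp add: D_def algebra_simps)
      moreover have "s * D \<le> m / 4 * s\<^sup>2 + D\<^sup>2 / m"
      proof -
        have "0 \<le> (m / 2 * s - D)\<^sup>2 / m" using m by simp
        also have "\<dots> = m / 4 * s\<^sup>2 + D\<^sup>2 / m - s * D"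
          using m by (simp add: power2_eq_square field_simps)
        finally show ?thesis by simp
      qed
      ultimately show ?thesis
        using m by (simp add: s_def algebra_simps)
    qed
  qed
qed

lemma strongly_convex_on_add_affine:
  assumes "strongly_convex_on m norm UNIV f"
  shows "strongly_convex_on m norm UNIV (\<lambda>v. f v + w \<bullet> v)"
  using assms unfolding strongly_convex_on_def
  by (simp add: inner_add_right algebra_simps)

lemma strongly_convex_affine_coercive:
  fixes f :: "'a::euclidean_space \<Rightarrow> real"
  assumes "strongly_convex_on m norm UNIV f" "m > 0" "continuous_on UNIV f"
  shows "\<exists>a>0. \<exists>c. \<forall>v. a * (norm v)\<^sup>2 - c \<le> f v + w \<bullet> v + b"
proof -
  have "continuous_on UNIV (\<lambda>v. f v + w \<bullet> v)"
    using assms by (intro continuous_intros)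
  then obtain c where "\<And>v. m / 4 * (norm v)\<^sup>2 - c \<le> f v + w \<bullet> v"
    using strongly_convex_quadratic_minorant[OF strongly_convex_on_add_affine[OF assms(1)] assms(2)]
    by blast
  then have "\<forall>v. m / 4 * (norm v)\<^sup>2 - (c - b) \<le> f v + w \<bullet> v + b"
    by (smt (verit))
  then show ?thesis
    using assms(2) by (intro exI[of _ "m / 4"] conjI exI[of _ "c - b"]) auto
qed

text \<open>A norm on a Euclidean space is convex, hence continuous, and so has a positive minimum on the
  unit sphere.\<close>

lemma is_norm_bounded_below:
  fixes N :: "'a::euclidean_space \<Rightarrow> real"
  assumes N: "is_norm N"
  obtains c where "c > 0" "\<And>u. c * norm u \<le> N u"
proof -
  have conv: "convex_on UNIV N"
    using N unfolding is_norm_def convex_on_def by (smt (verit) convex_UNIV)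
  have "continuous_on (sphere 0 1) N"
    using convex_on_continuous[OF open_UNIV conv] by (auto intro: continuous_on_subset)
  moreover have "sphere (0::'a) 1 \<noteq> {}"
    by simp
  ultimately obtain z where z: "z \<in> sphere 0 1" "\<And>u. u \<in> sphere 0 1 \<Longrightarrow> N z \<le> N u"
    using continuous_attains_inf[of "sphere (0::'a) 1" N] by auto
  have "N z \<noteq> 0" "0 \<le> N z"
    using z N by (auto simp: is_norm_def)
  moreover have "N z * norm u \<le> N u" for u
  proof (cases "u = 0")
    case True
    then show ?thesis using N by (simp add: is_norm_def)
  next
    case False
    then have "N z \<le> N ((1 / norm u) *\<^sub>R u)"
      by (intro z) simp
    also have "\<dots> = N u / norm u"
      using N by (simp add: is_norm_def)
    finally show ?thesis
      using False by (simp add: field_simps)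
  qed
  ultimately show thesis
    using that[of "N z"] by auto
qed

lemma differentiable_GDERIV_grad:
  fixes f :: "'a::euclidean_space \<Rightarrow> real"
  assumes "f differentiable (at u)"
  shows "GDERIV f u :> grad f u"
proof -
  obtain f' where f': "(f has_derivative f') (at u)"
    using assms by (auto simp: differentiable_def)
  then have lin: "linear f'"
    by (rule has_derivative_linear)
  define D where "D = (\<Sum>b\<in>Basis. f' b *\<^sub>R b)"
  have "f' h = h \<bullet> D" for h
  proof -
    have "f' h = f' (\<Sum>b\<in>Basis. (h \<bullet> b) *\<^sub>R b)"
      by (simp add: euclidean_representation)
    also have "\<dots> = (\<Sum>b\<in>Basis. (h \<bullet> b) * f' b)"
      using lin by (simp add: linear_sum linear_cmul)
    finally show ?thesis
      by (simp add: D_def inner_sum_right mult.commute)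
  qed
  then have D: "GDERIV f u :> D"
    using f' by (simp add: gderiv_def flip: \<open>\<And>h. f' h = h \<bullet> D\<close>)
  have "D' = D" if "GDERIV f u :> D'" for D'
    using has_derivative_unique[of f _ u] that D unfolding gderiv_def
    by (metis inner_commute vector_eq_ldot)
  with D show ?thesis
    unfolding grad_def by (metis theI)
qed

lemma GDERIV_slope:
  assumes "GDERIV f u :> D"
  shows "((\<lambda>t. (f (u + t *\<^sub>R d) - f u) / t) \<longlongrightarrow> D \<bullet> d) (at_right 0)"
proof -
  have f: "(f has_derivative (\<lambda>h. h \<bullet> D)) (at (u + 0 *\<^sub>R d))"
    using assms by (simp add: gderiv_def)
  have "((\<lambda>t::real. u + t *\<^sub>R d) has_derivative (\<lambda>t. t *\<^sub>R d)) (at 0)"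
    by (auto intro!: derivative_eq_intros)
  from has_derivative_compose[OF this f]
  have "((\<lambda>t. f (u + t *\<^sub>R d)) has_real_derivative D \<bullet> d) (at 0)"
    by (simp add: has_field_derivative_def inner_commute mult_commute_abs)
  then have "((\<lambda>t. (f (u + t *\<^sub>R d) - f u) / t) \<longlongrightarrow> D \<bullet> d) (at 0)"
    by (simp add: DERIV_def)
  then show ?thesis
    by (rule filterlim_mono) (auto simp: at_le)
qed

text \<open>Both bounds are first-order conditions along a ray: divide by \<open>t\<close> and let \<open>t\<close> tend to \<open>0\<close>.  The
  term \<open>(1 - t) * c\<close> carries the modulus of strong convexity.\<close>

lemma GDERIV_inner_le:
  assumes "GDERIV f u :> D"
    and le: "\<And>t. 0 < t \<Longrightarrow> t < 1 \<Longrightarrow> f (u + t *\<^sub>R d) - f u \<le> t * (b - (1 - t) * c)"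
  shows "D \<bullet> d \<le> b - c"
proof (rule tendsto_le[OF _ _ GDERIV_slope[OF assms(1)]])
  show "((\<lambda>t. b - (1 - t) * c) \<longlongrightarrow> b - c) (at_right 0)"
    by (auto intro!: tendsto_eq_intros)
  have "\<forall>\<^sub>F t::real in at_right 0. t \<in> {0<..<1}"
    by (rule eventually_at_right_real) simp
  then show "\<forall>\<^sub>F t in at_right 0. (f (u + t *\<^sub>R d) - f u) / t \<le> b - (1 - t) * c"
    by eventually_elim (use le in \<open>auto simp: field_simps\<close>)
qed simp

lemma GDERIV_inner_ge:
  assumes "GDERIV f u :> D"
    and ge: "\<And>t. 0 < t \<Longrightarrow> t < 1 \<Longrightarrow> t * b \<le> f (u + t *\<^sub>R d) - f u"
  shows "b \<le> D \<bullet> d"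
proof (rule tendsto_le[OF _ GDERIV_slope[OF assms(1)] tendsto_const])
  have "\<forall>\<^sub>F t::real in at_right 0. t \<in> {0<..<1}"
    by (rule eventually_at_right_real) simp
  then show "\<forall>\<^sub>F t in at_right 0. b \<le> (f (u + t *\<^sub>R d) - f u) / t"
    by eventually_elim (use ge in \<open>auto simp: field_simps\<close>)
qed simp

lemma segment_eq: "u + t *\<^sub>R (v - u) = (1 - t) *\<^sub>R u + t *\<^sub>R (v :: 'z::real_vector)"
  by (simp add: algebra_simps)


section \<open>Distance generating functions and their Bregman divergences\<close>

locale dgf =
  fixes U P :: "(real^'n) set" and N r :: "real^'n \<Rightarrow> real" and \<mu> :: real
  assumes dgf_setup: "dgf_setup U P N r \<mu>"
begin

lemma
  shows convex_U: "convex U" and closed_P: "closed P"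
    and convex_P: "convex P" and U_subset_P: "U \<subseteq> P" and U_interior: "U \<inter> interior P \<noteq> {}"
    and is_norm: "is_norm N" and convex_r: "convex_on P r" and continuous_r: "continuous_on P r"
    and mu_pos: "\<mu> > 0" and strongly_convex_r: "strongly_convex_on \<mu> N (U \<inter> interior P) r"
    and barrier: "U \<subseteq> interior P \<or>
      (\<forall>z\<in>frontier P. filterlim (\<lambda>u. norm (grad r u)) at_top (at z within interior P))"
  using dgf_setup by (auto simp: dgf_setup_def)

lemma GDERIV_r: "u \<in> interior P \<Longrightarrow> GDERIV r u :> grad r u"
  using dgf_setup by (auto simp: dgf_setup_def intro: differentiable_GDERIV_grad)

lemma r_segment_le:
  assumes "u \<in> P" "v \<in> P" "0 < t" "t < 1"
  shows "r (u + t *\<^sub>R (v - u)) - r u \<le> t * (r v - r u)"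
proof -
  have "r ((1 - t) *\<^sub>R u + t *\<^sub>R v) \<le> (1 - t) * r u + t * r v"
    using convex_r assms by (intro convex_onD) auto
  then show ?thesis
    by (simp add: segment_eq algebra_simps)
qed

lemma bregman_nonneg:
  assumes "u \<in> interior P" "v \<in> P"
  shows "0 \<le> bregman r u v"
proof -
  have "u \<in> P"
    using assms interior_subset by blast
  then have "grad r u \<bullet> (v - u) \<le> r v - r u - 0"
    using r_segment_le assms by (intro GDERIV_inner_le[OF GDERIV_r]) auto
  then show ?thesis
    by (simp add: bregman_def)
qed

lemma interior_segment:
  assumes "p \<in> interior P" "v \<in> P" "0 < t" "t \<le> 1"
  shows "v + t *\<^sub>R (p - v) \<in> interior P"
  using mem_interior_convex_shrink[OF convex_P assms] by (simp add: algebra_simps)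

lemma bregman_strongly_convex_interior:
  assumes "u \<in> U \<inter> interior P" "v \<in> U \<inter> interior P"
  shows "\<mu> / 2 * (N (v - u))\<^sup>2 \<le> bregman r u v"
proof -
  have "grad r u \<bullet> (v - u) \<le> (r v - r u) - \<mu> / 2 * (N (v - u))\<^sup>2"
  proof (rule GDERIV_inner_le)
    show "GDERIV r u :> grad r u"
      using assms by (simp add: GDERIV_r)
    fix t :: real assume "0 < t" "t < 1"
    then have "r (t *\<^sub>R v + (1 - t) *\<^sub>R u)
        \<le> t * r v + (1 - t) * r u - \<mu> / 2 * t * (1 - t) * (N (v - u))\<^sup>2"
      using strongly_convex_r assms by (auto simp: strongly_convex_on_def)
    then show "r (u + t *\<^sub>R (v - u)) - r u \<le> t * (r v - r u - (1 - t) * (\<mu> / 2 * (N (v - u))\<^sup>2))"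
      by (simp add: segment_eq algebra_simps)
  qed
  then show ?thesis
    by (simp add: bregman_def)
qed

text \<open>Strong convexity of \<open>r\<close> is available in the interior of \<open>P\<close> only, whereas \<open>Y\<close> may touch the
  boundary.  Continuity of \<open>r\<close> along the segment from \<open>v\<close> to \<open>u\<close>, which runs in the interior except
  possibly at \<open>v\<close>, extends the bound.\<close>

lemma bregman_strongly_convex:
  assumes u: "u \<in> U \<inter> interior P" and v: "v \<in> U"
  shows "\<mu> / 2 * (N (v - u))\<^sup>2 \<le> bregman r u v"
proof (rule tendsto_le)
  let ?w = "\<lambda>t::real. v + t *\<^sub>R (u - v)"
  have ev: "\<forall>\<^sub>F t::real in at_right 0. t \<in> {0<..<1}"
    by (rule eventually_at_right_real) simp
  have P: "v \<in> P" "?w t \<in> U \<inter> interior P" if "t \<in> {0<..<1}" for t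
  proof -
    show "v \<in> P"
      using v U_subset_P by auto
    then show "?w t \<in> U \<inter> interior P"
      using that u v interior_segment[of u v t] convexD_alt[OF convex_U, of v u t]
      by (auto simp: segment_eq)
  qed
  show "((\<lambda>t. \<mu> / 2 * ((1 - t) * N (v - u))\<^sup>2) \<longlongrightarrow> \<mu> / 2 * (N (v - u))\<^sup>2) (at_right 0)"
    by (auto intro!: tendsto_eq_intros)
  have w: "(?w \<longlongrightarrow> v) (at_right 0)"
    by (auto intro!: tendsto_eq_intros)
  have "\<forall>\<^sub>F t in at_right 0. ?w t \<in> P"
    using ev by eventually_elim (use P interior_subset in blast)
  then have "((\<lambda>t. r (?w t)) \<longlongrightarrow> r v) (at_right 0)"
    using continuous_on_tendsto_compose[OF continuous_r w] v U_subset_P by auto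
  then show "((\<lambda>t. bregman r u (?w t)) \<longlongrightarrow> bregman r u v) (at_right 0)"
    unfolding bregman_def by (intro tendsto_intros w)
  show "\<forall>\<^sub>F t in at_right 0. \<mu> / 2 * ((1 - t) * N (v - u))\<^sup>2 \<le> bregman r u (?w t)"
    using ev
  proof eventually_elim
    case (elim t)
    have "?w t - u = (1 - t) *\<^sub>R (v - u)"
      by (simp add: algebra_simps)
    then have "N (?w t - u) = (1 - t) * N (v - u)"
      using is_norm elim by (simp add: is_norm_def)
    then show ?case
      using bregman_strongly_convex_interior[OF u P(2)[OF elim]] by simp
  qed
qed simp

text \<open>The bound in the Euclidean norm, uniform in the centre, is what the limits in the finite
  dimensional space below are based on.\<close>

lemma bregman_quadratic_growth:
  obtains c where "c > 0"
    "\<And>u v. u \<in> U \<inter> interior P \<Longrightarrow> v \<in> U \<Longrightarrow> c * (norm (v - u))\<^sup>2 \<le> bregman r u v"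
proof -
  obtain c where c: "c > 0" "\<And>u. c * norm u \<le> N u"
    using is_norm_bounded_below[OF is_norm] by blast
  show thesis
  proof (rule that)
    show "\<mu> / 2 * c\<^sup>2 > 0"
      using c mu_pos by simp
    fix u v assume "u \<in> U \<inter> interior P" "v \<in> U"
    then have "\<mu> / 2 * (N (v - u))\<^sup>2 \<le> bregman r u v"
      by (rule bregman_strongly_convex)
    moreover have "\<mu> / 2 * (c * norm (v - u))\<^sup>2 \<le> \<mu> / 2 * (N (v - u))\<^sup>2"
      using c mu_pos by (intro mult_left_mono power_mono) auto
    ultimately show "\<mu> / 2 * c\<^sup>2 * (norm (v - u))\<^sup>2 \<le> bregman r u v"
      by (simp add: power_mult_distrib)
  qed
qed

text \<open>If \<open>z\<close> were on the boundary, approach it along the segment from the interior point \<open>p\<close>.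
  Maximality of \<open>z\<close> and concavity of \<open>G\<close> prevent \<open>r\<close> from falling faster than linearly when
  leaving \<open>z\<close>, so that the slope of \<open>r\<close> in direction \<open>p - z\<close> stays bounded below.  Since \<open>r\<close> is
  bounded above on a ball around \<open>p\<close>, the gradient inequality at the points of the segment then
  bounds the norm of the whole gradient, contradicting its divergence at the boundary.\<close>

lemma regularized_maximizer_interior:
  assumes S: "convex S" "S \<subseteq> U" and p: "p \<in> S \<inter> interior P" and z: "z \<in> S"
    and G: "concave_on S G" and \<Lambda>: "\<Lambda> > 0"
    and max: "\<And>v. v \<in> S \<Longrightarrow> G v - \<Lambda> * r v \<le> G z - \<Lambda> * r z"
  shows "z \<in> interior P"
proof (rule ccontr)
  assume nint: "z \<notin> interior P"
  have zP: "z \<in> P"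
    using z S U_subset_P by auto
  then have "z \<in> frontier P"
    using nint closed_P by (simp add: frontier_def)
  then have lim: "filterlim (\<lambda>u. norm (grad r u)) at_top (at z within interior P)"
    using barrier nint z S by auto
  let ?w = "\<lambda>t::real. z + t *\<^sub>R (p - z)"
  have ev: "\<forall>\<^sub>F t::real in at_right 0. t \<in> {0<..<1}"
    by (rule eventually_at_right_real) simp
  have wint: "?w t \<in> interior P" if "t \<in> {0<..<1}" for t
    using that p zP by (intro interior_segment) auto
  have wS: "?w t \<in> S" if "t \<in> {0<..<1}" for t
    using that convexD_alt[OF S(1), of z p t] z p by (auto simp: segment_eq)
  have "filterlim ?w (at z within interior P) (at_right 0)"
    unfolding filterlim_at
  proof
    show "(?w \<longlongrightarrow> z) (at_right 0)"
      by (auto intro!: tendsto_eq_intros)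
    show "\<forall>\<^sub>F t in at_right 0. ?w t \<in> interior P \<and> ?w t \<noteq> z"
      using ev by eventually_elim (use wint nint in metis)
  qed
  then have blowup: "filterlim (\<lambda>t. norm (grad r (?w t))) at_top (at_right 0)"
    by (rule filterlim_compose[OF lim])
  define C where "C = (G z - G p) / \<Lambda>"
  obtain \<delta> where \<delta>: "\<delta> > 0" "cball p \<delta> \<subseteq> P"
    using p by (auto simp: mem_interior_cball)
  obtain m where m: "\<And>v. v \<in> cball p \<delta> \<Longrightarrow> r v \<le> m"
  proof -
    have "continuous_on (cball p \<delta>) r"
      using \<delta> continuous_r continuous_on_subset by blast
    then show thesis
      using continuous_attains_sup[of "cball p \<delta>" r] \<delta> that by fastforce
  qed
  have bound: "norm (grad r (?w t)) \<le> (m - r z + 2 * \<bar>C\<bar>) / \<delta>" if t: "t \<in> {0<..<1}" for t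
  proof -
    let ?d = "grad r (?w t)"
    have "G ((1 - t) *\<^sub>R z + t *\<^sub>R p) \<ge> (1 - t) * G z + t * G p"
      using G t z p by (intro concave_onD) auto
    then have "\<Lambda> * (r (?w t) - r z) \<ge> t * (G p - G z)"
      using max[OF wS[OF t]] by (simp add: segment_eq algebra_simps)
    then have r_low: "r (?w t) - r z \<ge> - t * C"
      using \<Lambda> by (simp add: C_def field_simps)
    have "r z \<ge> r (?w t) + ?d \<bullet> (z - ?w t)"
      using bregman_nonneg[OF wint[OF t] zP] by (simp add: bregman_def)
    then have "t * - C \<le> t * (?d \<bullet> (p - z))"
      using r_low by simp
    then have slope: "- C \<le> ?d \<bullet> (p - z)"
      using t by (subst (asm) mult_le_cancel_left_pos) auto
    \<comment> \<open>Testing the gradient inequality at the point of the ball around p that lies furthest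
      in the direction of the gradient produces the norm of the gradient.\<close>
    define e where "e = sgn ?d"
    have e: "?d \<bullet> e = norm ?d"
      by (cases "?d = 0")
        (simp_all add: e_def sgn_div_norm power2_norm_eq_inner[symmetric] power2_eq_square)
    have mem: "p + \<delta> *\<^sub>R e \<in> cball p \<delta>"
      using \<delta> by (simp add: e_def dist_norm norm_sgn)
    then have "m \<ge> r (?w t) + ?d \<bullet> (p + \<delta> *\<^sub>R e - ?w t)"
      using bregman_nonneg[OF wint[OF t], of "p + \<delta> *\<^sub>R e"] m[OF mem] \<delta>(2) by (auto simp: bregman_def)
    also have "p + \<delta> *\<^sub>R e - ?w t = \<delta> *\<^sub>R e + (1 - t) *\<^sub>R (p - z)"
      by (simp add: algebra_simps)
    finally have "m \<ge> r (?w t) + \<delta> * norm ?d + (1 - t) * (?d \<bullet> (p - z))"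
      by (simp add: inner_add_right e)
    moreover have "(1 - t) * (?d \<bullet> (p - z)) \<ge> (1 - t) * - C"
      using slope t by (intro mult_left_mono) auto
    moreover have "\<bar>(1 - t) * C\<bar> \<le> \<bar>C\<bar>" "\<bar>t * C\<bar> \<le> \<bar>C\<bar>"
      using t by (simp_all add: abs_mult mult_left_le_one_le)
    ultimately have "\<delta> * norm ?d \<le> m - r z + 2 * \<bar>C\<bar>"
      using r_low by (simp add: abs_le_iff)
    then show ?thesis
      using \<delta> by (simp add: field_simps)
  qed
  have "\<forall>\<^sub>F t in at_right 0. norm (grad r (?w t)) > (m - r z + 2 * \<bar>C\<bar>) / \<delta>"
    using blowup by (auto simp: filterlim_at_top_dense)
  with ev have "\<forall>\<^sub>F t::real in at_right 0. False"
    by eventually_elim (use bound in force)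
  then show False
    by simp
qed

lemma regularized_maximizer_first_order:
  assumes S: "convex S" "S \<subseteq> P" and z: "z \<in> S \<inter> interior P" and v: "v \<in> S"
    and G: "concave_on S G" and \<Lambda>: "\<Lambda> > 0"
    and max: "\<And>v. v \<in> S \<Longrightarrow> G v - \<Lambda> * r v \<le> G z - \<Lambda> * r z"
  shows "G v - G z \<le> \<Lambda> * (grad r z \<bullet> (v - z))"
proof -
  have "(G v - G z) / \<Lambda> \<le> grad r z \<bullet> (v - z)"
  proof (rule GDERIV_inner_ge[OF GDERIV_r])
    fix t :: real assume t: "0 < t" "t < 1"
    let ?w = "z + t *\<^sub>R (v - z)"
    have "?w \<in> S"
      using t convexD_alt[OF S(1), of z v t] z v by (auto simp: segment_eq)
    from max[OF this] have "G ?w - G z \<le> \<Lambda> * (r ?w - r z)"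
      by (simp add: algebra_simps)
    moreover have "G ((1 - t) *\<^sub>R z + t *\<^sub>R v) \<ge> (1 - t) * G z + t * G v"
      using G t z v by (intro concave_onD) auto
    ultimately have "t * (G v - G z) \<le> \<Lambda> * (r ?w - r z)"
      by (simp add: segment_eq algebra_simps)
    then show "t * ((G v - G z) / \<Lambda>) \<le> r ?w - r z"
      using \<Lambda> by (simp add: field_simps)
  qed (use z in auto)
  then show ?thesis
    using \<Lambda> by (simp add: field_simps)
qed

corollary regularized_maximizer_three_point:
  assumes S: "convex S" "S \<subseteq> P" and z: "z \<in> S \<inter> interior P" and v: "v \<in> S"
    and G: "concave_on S G" and \<Lambda>: "\<Lambda> > 0"
    and max: "\<And>v. v \<in> S \<Longrightarrow> G v - \<Lambda> * r v \<le> G z - \<Lambda> * r z"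
  shows "G v - \<Lambda> * r v + \<Lambda> * bregman r z v \<le> G z - \<Lambda> * r z"
  using regularized_maximizer_first_order[OF assms]
  by (simp add: bregman_def algebra_simps)

text \<open>The components of the gradient are limits of difference quotients of \<open>r\<close>.  Since \<open>r\<close> is
  controlled on \<open>P\<close> only, it is first cut off outside the interior of \<open>P\<close>.\<close>

lemma measurable_grad_comp:
  assumes Y: "Y \<in> borel_measurable M" and int: "\<And>\<omega>. \<omega> \<in> space M \<Longrightarrow> Y \<omega> \<in> interior P"
  shows "(\<lambda>\<omega>. grad r (Y \<omega>)) \<in> borel_measurable M"
proof -
  define r' where "r' = (\<lambda>v. indicator (interior P) v *\<^sub>R r v)"
  have r': "r' \<in> borel_measurable borel"
    unfolding r'_def using continuous_r interior_subset[of P]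
    by (intro borel_measurable_continuous_on_indicator) (auto intro: continuous_on_subset)
  have "(\<lambda>\<omega>. grad r (Y \<omega>) \<bullet> b) \<in> borel_measurable M" for b
  proof (rule borel_measurable_LIMSEQ_real)
    let ?t = "\<lambda>n. 1 / real (Suc n)"
    show "(\<lambda>\<omega>. (r' (Y \<omega> + ?t n *\<^sub>R b) - r' (Y \<omega>)) / ?t n) \<in> borel_measurable M" for n
      using r' Y by measurable
    fix \<omega> assume "\<omega> \<in> space M"
    then have Y\<omega>: "Y \<omega> \<in> interior P"
      by (rule int)
    have t0: "?t \<longlonglongrightarrow> 0"
      by (rule LIMSEQ_Suc[OF lim_1_over_n])
    then have "filterlim ?t (at_right 0) sequentially"
      by (auto simp: filterlim_at eventually_sequentially)
    from filterlim_compose[OF GDERIV_slope[OF GDERIV_r[OF Y\<omega>]] this]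
    have lim: "(\<lambda>n. (r (Y \<omega> + ?t n *\<^sub>R b) - r (Y \<omega>)) / ?t n) \<longlonglongrightarrow> grad r (Y \<omega>) \<bullet> b" .
    have "(\<lambda>n. Y \<omega> + ?t n *\<^sub>R b) \<longlonglongrightarrow> Y \<omega> + 0 *\<^sub>R b"
      by (intro tendsto_intros t0)
    then have "\<forall>\<^sub>F n in sequentially. Y \<omega> + ?t n *\<^sub>R b \<in> interior P"
      using Y\<omega> by (auto elim!: topological_tendstoD)
    then show "(\<lambda>n. (r' (Y \<omega> + ?t n *\<^sub>R b) - r' (Y \<omega>)) / ?t n) \<longlonglongrightarrow> grad r (Y \<omega>) \<bullet> b"
      by (intro Lim_transform_eventually[OF lim], eventually_elim) (simp add: r'_def Y\<omega>)
  qed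
  then show ?thesis
    by (subst borel_measurable_euclidean_space) auto
qed

end

section \<open>The Bregman-regularized saddle point problem\<close>

locale dual_extraction =
  fixes \<psi> :: "real^'d \<Rightarrow> real^'n \<Rightarrow> real"
    and X :: "(real^'d) set" and Y U P :: "(real^'n) set"
    and N r :: "real^'n \<Rightarrow> real" and \<mu> :: real
  assumes extraction_setup: "dual_extraction_setup \<psi> X Y U P N r \<mu>"
begin

sublocale dgf U P N r \<mu>
  using extraction_setup by unfold_locales (simp add: dual_extraction_setup_def)

lemma
  shows convex_psi: "convex_on UNIV (\<lambda>x. \<psi> x v)" and concave_psi: "concave_on UNIV (\<psi> x)"
    and X_nonempty: "X \<noteq> {}" and closed_X: "closed X" and convex_X: "convex X"
    and Y_nonempty: "Y \<noteq> {}" and closed_Y: "closed Y" and convex_Y: "convex Y"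
    and Y_subset_U: "Y \<subseteq> U" and Y_interior: "Y \<inter> interior P \<noteq> {}"
    and X_cases: "bounded X \<or> (\<exists>m>0. strongly_convex_on m norm UNIV (\<lambda>x. \<psi> x v))"
    and Y_cases: "bounded Y \<or> (\<exists>m>0. strongly_convex_on m norm UNIV (\<lambda>y. - \<psi> x y))"
    and normal_constant: "p \<in> U \<inter> interior P \<Longrightarrow> w \<in> subdifferential (indicator_ext U) p \<Longrightarrow>
      (\<lambda>y. w \<bullet> y) constant_on Y"
  using extraction_setup by (auto simp: dual_extraction_setup_def)

lemma Y_subset_P: "Y \<subseteq> P"
  using Y_subset_U U_subset_P by blast

lemma continuous_psi_left: "continuous_on S (\<lambda>x. \<psi> x v)"
  using convex_on_continuous[OF open_UNIV convex_psi] continuous_on_subset by blast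

lemma continuous_psi_right: "continuous_on S (\<psi> x)"
proof -
  have "continuous_on UNIV (\<lambda>v. - \<psi> x v)"
    using convex_on_continuous[OF open_UNIV] concave_psi by (auto simp: concave_on_def)
  then show ?thesis
    using continuous_on_minus[of UNIV "\<lambda>v. - \<psi> x v"] continuous_on_subset by auto
qed

lemma psi_attains_min:
  obtains x where "x \<in> X" "\<And>x'. x' \<in> X \<Longrightarrow> \<psi> x v \<le> \<psi> x' v"
proof (rule continuous_attains_inf_coercive[OF closed_X X_nonempty continuous_psi_left])
  show "bounded X \<or> (\<exists>a>0. \<exists>c. \<forall>x\<in>X. a * (norm x)\<^sup>2 - c \<le> \<psi> x v)"
    using X_cases[of v]
  proof (elim disjE exE conjE)
    fix m :: real assume "0 < m" "strongly_convex_on m norm UNIV (\<lambda>x. \<psi> x v)"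
    then show ?thesis
      using strongly_convex_affine_coercive[OF _ _ continuous_psi_left, of m v 0 0] by auto
  qed simp
qed (use that in blast)

lemma primal_min_eq: "x \<in> X \<Longrightarrow> (\<And>x'. x' \<in> X \<Longrightarrow> \<psi> x v \<le> \<psi> x' v) \<Longrightarrow> primal_min \<psi> X v = \<psi> x v"
  unfolding primal_min_def by (intro cInf_eq_minimum) auto

lemma primal_min_le: "x \<in> X \<Longrightarrow> primal_min \<psi> X v \<le> \<psi> x v"
  by (metis primal_min_eq psi_attains_min)

lemma continuous_primal_min: "continuous_on UNIV (primal_min \<psi> X)"
proof -
  have "convex_on UNIV (\<lambda>v. - primal_min \<psi> X v)"
  proof (rule convex_onI)
    fix t :: real and v w :: "real^'n" assume t: "0 < t" "t < 1"
    obtain x where x: "x \<in> X" "primal_min \<psi> X ((1 - t) *\<^sub>R v + t *\<^sub>R w) = \<psi> x ((1 - t) *\<^sub>R v + t *\<^sub>R w)"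
      by (metis psi_attains_min primal_min_eq)
    have "(1 - t) * primal_min \<psi> X v + t * primal_min \<psi> X w \<le> (1 - t) * \<psi> x v + t * \<psi> x w"
      using t x by (intro add_mono mult_left_mono primal_min_le) auto
    also have "\<dots> \<le> \<psi> x ((1 - t) *\<^sub>R v + t *\<^sub>R w)"
      using t concave_psi[of x] by (intro concave_onD) auto
    finally show "- primal_min \<psi> X ((1 - t) *\<^sub>R v + t *\<^sub>R w)
        \<le> (1 - t) * - primal_min \<psi> X v + t * - primal_min \<psi> X w"
      by (simp add: x)
  qed simp
  from convex_on_continuous[OF open_UNIV this] show ?thesis
    using continuous_on_minus by fastforce
qed

text \<open>Up to terms that do not depend on \<open>v\<close>, the payoff \<open>\<psi> x v - (\<Sum>j<k. l j * bregman r (y j) v)\<close>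
  depends on the centres only through \<open>\<Lambda> = (\<Sum>j<k. l j)\<close> and \<open>g = (\<Sum>j<k. l j *\<^sub>R grad r (y j))\<close>.
  Dropping those terms leaves the payoff below.  It is convex in \<open>(g, x)\<close> jointly, which the
  parametrization by the centres would hide.\<close>

definition reg_payoff :: "real \<Rightarrow> real^'n \<Rightarrow> real^'d \<Rightarrow> real^'n \<Rightarrow> real" where
  "reg_payoff \<Lambda> g x v = \<psi> x v + g \<bullet> v - \<Lambda> * r v"

definition reg_max :: "real \<Rightarrow> real^'n \<Rightarrow> real^'d \<Rightarrow> real" where
  "reg_max \<Lambda> g x = (SUP v\<in>Y. reg_payoff \<Lambda> g x v)"

definition response :: "real \<Rightarrow> real^'n \<Rightarrow> real^'d \<Rightarrow> real^'n" where
  "response \<Lambda> g x = (SOME v. v \<in> Y \<and> (\<forall>w\<in>Y. reg_payoff \<Lambda> g x w \<le> reg_payoff \<Lambda> g x v))"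

definition saddle_value :: "real \<Rightarrow> real^'n \<Rightarrow> real" where
  "saddle_value \<Lambda> g = (INF x\<in>X. reg_max \<Lambda> g x)"

lemma continuous_reg_payoff: "continuous_on Y (reg_payoff \<Lambda> g x)"
  unfolding reg_payoff_def
  by (intro continuous_intros continuous_psi_right continuous_on_subset[OF continuous_r Y_subset_P])

text \<open>If \<open>Y\<close> is unbounded, then \<open>- \<psi> x\<close> is strongly convex, and the convex \<open>r\<close> can be replaced by its
  tangent at a point of \<open>Y\<close> in the interior of \<open>P\<close>, which is affine and does no harm to coercivity.\<close>

lemma reg_payoff_attains_max:
  assumes "\<Lambda> > 0"
  shows "\<exists>v. v \<in> Y \<and> (\<forall>w\<in>Y. reg_payoff \<Lambda> g x w \<le> reg_payoff \<Lambda> g x v)"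
proof -
  have "continuous_on Y (\<lambda>v. - reg_payoff \<Lambda> g x v)"
    by (intro continuous_intros continuous_reg_payoff)
  moreover have "bounded Y \<or> (\<exists>a>0. \<exists>c. \<forall>v\<in>Y. a * (norm v)\<^sup>2 - c \<le> - reg_payoff \<Lambda> g x v)"
    using Y_cases[of x]
  proof (elim disjE exE conjE)
    fix m :: real assume m: "0 < m" and sc: "strongly_convex_on m norm UNIV (\<lambda>y. - \<psi> x y)"
    obtain p where p: "p \<in> Y \<inter> interior P"
      using Y_interior by auto
    let ?w = "\<Lambda> *\<^sub>R grad r p - g" and ?b = "\<Lambda> * (r p - grad r p \<bullet> p)"
    have "continuous_on UNIV (\<lambda>y. - \<psi> x y)"
      by (intro continuous_intros continuous_psi_right)
    from strongly_convex_affine_coercive[OF sc m this, of ?w ?b]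
    obtain a c where a: "a > 0" and c: "\<And>v. a * (norm v)\<^sup>2 - c \<le> - \<psi> x v + ?w \<bullet> v + ?b"
      by blast
    have "- \<psi> x v + ?w \<bullet> v + ?b \<le> - reg_payoff \<Lambda> g x v" if "v \<in> Y" for v
    proof -
      have "0 \<le> \<Lambda> * bregman r p v"
        using bregman_nonneg[of p v] p that Y_subset_P assms by auto
      then show ?thesis
        by (simp add: reg_payoff_def bregman_def algebra_simps)
    qed
    with a c show ?thesis
      by (meson order_trans)
  qed simp
  ultimately obtain v where "v \<in> Y" "\<And>w. w \<in> Y \<Longrightarrow> - reg_payoff \<Lambda> g x v \<le> - reg_payoff \<Lambda> g x w"
    using continuous_attains_inf_coercive[OF closed_Y Y_nonempty] by blast
  then show ?thesis
    by auto
qed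

lemma
  assumes "\<Lambda> > 0"
  shows response_in_Y: "response \<Lambda> g x \<in> Y"
    and reg_payoff_le_response: "w \<in> Y \<Longrightarrow> reg_payoff \<Lambda> g x w \<le> reg_payoff \<Lambda> g x (response \<Lambda> g x)"
  using someI_ex[OF reg_payoff_attains_max[OF assms, of g x]] by (auto simp: response_def)

lemma reg_max_eq: "\<Lambda> > 0 \<Longrightarrow> reg_max \<Lambda> g x = reg_payoff \<Lambda> g x (response \<Lambda> g x)"
  unfolding reg_max_def
  by (intro cSup_eq_maximum) (auto simp: response_in_Y reg_payoff_le_response)

lemma reg_payoff_le_max: "\<Lambda> > 0 \<Longrightarrow> v \<in> Y \<Longrightarrow> reg_payoff \<Lambda> g x v \<le> reg_max \<Lambda> g x"
  by (simp add: reg_max_eq reg_payoff_le_response)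

lemma concave_linear_perturbation:
  assumes "convex S" shows "concave_on S (\<lambda>v. \<psi> x v + g \<bullet> v)"
  using concave_psi[of x] assms unfolding concave_on_def convex_on_def
  by (auto simp: inner_add_right algebra_simps)

text \<open>The best response satisfies first-order optimality with respect to \<open>r\<close>, which turns the gain
  of the best response over any other \<open>v\<close> into a Bregman divergence centred at the response.\<close>

lemma
  assumes \<Lambda>: "\<Lambda> > 0"
  shows response_interior: "response \<Lambda> g x \<in> interior P"
    and response_three_point: "v \<in> Y \<Longrightarrow>
      reg_payoff \<Lambda> g x v + \<Lambda> * bregman r (response \<Lambda> g x) v \<le> reg_max \<Lambda> g x"
proof -
  let ?z = "response \<Lambda> g x" and ?G = "\<lambda>v. \<psi> x v + g \<bullet> v"
  have max: "?G v - \<Lambda> * r v \<le> ?G ?z - \<Lambda> * r ?z" if "v \<in> Y" for v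
    using reg_payoff_le_response[OF \<Lambda> that] by (simp add: reg_payoff_def)
  obtain p where "p \<in> Y \<inter> interior P"
    using Y_interior by auto
  then show int: "?z \<in> interior P"
    using regularized_maximizer_interior[OF convex_Y Y_subset_U]
      response_in_Y[OF \<Lambda>] concave_linear_perturbation[OF convex_Y] \<Lambda> max by blast
  assume "v \<in> Y"
  then show "reg_payoff \<Lambda> g x v + \<Lambda> * bregman r ?z v \<le> reg_max \<Lambda> g x"
    using regularized_maximizer_three_point[OF convex_Y Y_subset_P _ _
        concave_linear_perturbation[OF convex_Y] \<Lambda> max] int response_in_Y[OF \<Lambda>]
    by (simp add: reg_max_eq[OF \<Lambda>] reg_payoff_def)
qed

lemma response_quadratic_growth:
  obtains c where "c > 0" "\<And>\<Lambda> g x v. \<Lambda> > 0 \<Longrightarrow> v \<in> Y \<Longrightarrow>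
    reg_payoff \<Lambda> g x v + \<Lambda> * c * (norm (v - response \<Lambda> g x))\<^sup>2 \<le> reg_max \<Lambda> g x"
proof -
  obtain c where c: "c > 0"
    "\<And>u v. u \<in> U \<inter> interior P \<Longrightarrow> v \<in> U \<Longrightarrow> c * (norm (v - u))\<^sup>2 \<le> bregman r u v"
    using bregman_quadratic_growth by blast
  show thesis
  proof (rule that[OF c(1)])
    fix \<Lambda> :: real and g x v assume \<Lambda>: "\<Lambda> > 0" and v: "v \<in> Y"
    have "c * (norm (v - response \<Lambda> g x))\<^sup>2 \<le> bregman r (response \<Lambda> g x) v"
      using c(2) response_interior[OF \<Lambda>] response_in_Y[OF \<Lambda>] v Y_subset_U by blast
    then have "\<Lambda> * (c * (norm (v - response \<Lambda> g x))\<^sup>2) \<le> \<Lambda> * bregman r (response \<Lambda> g x) v"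
      using \<Lambda> by (intro mult_left_mono) auto
    with response_three_point[OF \<Lambda> v, of g x]
    show "reg_payoff \<Lambda> g x v + \<Lambda> * c * (norm (v - response \<Lambda> g x))\<^sup>2 \<le> reg_max \<Lambda> g x"
      by (simp add: mult.assoc)
  qed
qed

lemma response_unique:
  assumes \<Lambda>: "\<Lambda> > 0" and v: "v \<in> Y" "\<And>w. w \<in> Y \<Longrightarrow> reg_payoff \<Lambda> g x w \<le> reg_payoff \<Lambda> g x v"
  shows "v = response \<Lambda> g x"
proof -
  obtain c where c: "c > 0"
    "reg_payoff \<Lambda> g x v + \<Lambda> * c * (norm (v - response \<Lambda> g x))\<^sup>2 \<le> reg_max \<Lambda> g x"
    using response_quadratic_growth \<Lambda> v(1) by metis
  have "\<Lambda> * c * (norm (v - response \<Lambda> g x))\<^sup>2 \<le> 0"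
    using c(2) v(2)[OF response_in_Y[OF \<Lambda>], of g x] by (simp add: reg_max_eq[OF \<Lambda>])
  then show ?thesis
    using \<Lambda> c(1) by (auto simp: mult_le_0_iff)
qed

lemma reg_payoff_convex:
  assumes "0 \<le> t" "t \<le> 1"
  shows "reg_payoff \<Lambda> ((1 - t) *\<^sub>R g1 + t *\<^sub>R g2) ((1 - t) *\<^sub>R x1 + t *\<^sub>R x2) v
    \<le> (1 - t) * reg_payoff \<Lambda> g1 x1 v + t * reg_payoff \<Lambda> g2 x2 v"
proof -
  have "\<psi> ((1 - t) *\<^sub>R x1 + t *\<^sub>R x2) v \<le> (1 - t) * \<psi> x1 v + t * \<psi> x2 v"
    using convex_psi[of v] assms by (intro convex_onD) auto
  then show ?thesis
    by (simp add: reg_payoff_def inner_add_left algebra_simps)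
qed

lemma reg_max_convex:
  assumes \<Lambda>: "\<Lambda> > 0" and t: "0 \<le> t" "t \<le> 1"
  shows "reg_max \<Lambda> ((1 - t) *\<^sub>R g1 + t *\<^sub>R g2) ((1 - t) *\<^sub>R x1 + t *\<^sub>R x2)
    \<le> (1 - t) * reg_max \<Lambda> g1 x1 + t * reg_max \<Lambda> g2 x2"
proof -
  let ?g = "(1 - t) *\<^sub>R g1 + t *\<^sub>R g2" and ?x = "(1 - t) *\<^sub>R x1 + t *\<^sub>R x2"
  have "reg_max \<Lambda> ?g ?x \<le> (1 - t) * reg_payoff \<Lambda> g1 x1 (response \<Lambda> ?g ?x)
      + t * reg_payoff \<Lambda> g2 x2 (response \<Lambda> ?g ?x)"
    unfolding reg_max_eq[OF \<Lambda>, of ?g ?x] by (rule reg_payoff_convex[OF t])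
  also have "\<dots> \<le> (1 - t) * reg_max \<Lambda> g1 x1 + t * reg_max \<Lambda> g2 x2"
    using t \<Lambda> by (intro add_mono mult_left_mono reg_payoff_le_max response_in_Y) auto
  finally show ?thesis .
qed

text \<open>A finite convex function on a whole Euclidean space is continuous.\<close>

lemma continuous_reg_max:
  assumes \<Lambda>: "\<Lambda> > 0"
  shows "continuous_on UNIV (\<lambda>z. reg_max \<Lambda> (fst z) (snd z))"
proof (rule convex_on_continuous[OF open_UNIV])
  show "convex_on UNIV (\<lambda>z. reg_max \<Lambda> (fst z) (snd z))"
    using reg_max_convex[OF \<Lambda>] by (intro convex_onI) auto
qed

lemma reg_max_attains_min:
  assumes \<Lambda>: "\<Lambda> > 0"
  obtains x where "x \<in> X" "reg_max \<Lambda> g x = saddle_value \<Lambda> g"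
    "\<And>x'. x' \<in> X \<Longrightarrow> saddle_value \<Lambda> g \<le> reg_max \<Lambda> g x'"
proof -
  obtain p where p: "p \<in> Y"
    using Y_nonempty by auto
  have "continuous_on X ((\<lambda>z. reg_max \<Lambda> (fst z) (snd z)) \<circ> (\<lambda>x. (g, x)))"
    by (intro continuous_on_compose continuous_intros continuous_on_subset[OF continuous_reg_max[OF \<Lambda>]]) auto
  then have "continuous_on X (reg_max \<Lambda> g)"
    by (simp add: o_def)
  moreover have "bounded X \<or> (\<exists>a>0. \<exists>c. \<forall>x\<in>X. a * (norm x)\<^sup>2 - c \<le> reg_max \<Lambda> g x)"
    using X_cases[of p]
  proof (elim disjE exE conjE)
    fix m :: real assume m: "0 < m" and sc: "strongly_convex_on m norm UNIV (\<lambda>x. \<psi> x p)"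
    from strongly_convex_affine_coercive[OF sc m continuous_psi_left, of 0 "g \<bullet> p - \<Lambda> * r p"]
    obtain a c where "a > 0" "\<And>x. a * (norm x)\<^sup>2 - c \<le> reg_payoff \<Lambda> g x p"
      by (auto simp: reg_payoff_def algebra_simps)
    then show ?thesis
      using reg_payoff_le_max[OF \<Lambda> p] by (meson order_trans)
  qed simp
  ultimately obtain x where x: "x \<in> X" "\<And>x'. x' \<in> X \<Longrightarrow> reg_max \<Lambda> g x \<le> reg_max \<Lambda> g x'"
    using continuous_attains_inf_coercive[OF closed_X X_nonempty] by blast
  then have "saddle_value \<Lambda> g = reg_max \<Lambda> g x"
    unfolding saddle_value_def by (intro cInf_eq_minimum) auto
  with x show thesis
    by (intro that[of x]) auto
qed

lemma saddle_value_le: "\<Lambda> > 0 \<Longrightarrow> x \<in> X \<Longrightarrow> saddle_value \<Lambda> g \<le> reg_max \<Lambda> g x"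
  by (metis reg_max_attains_min)

text \<open>Partial minimization of the jointly convex \<open>reg_max\<close> over the convex set \<open>X\<close> keeps convexity
  in \<open>g\<close>.\<close>

lemma continuous_saddle_value:
  assumes \<Lambda>: "\<Lambda> > 0"
  shows "continuous_on UNIV (saddle_value \<Lambda>)"
proof (rule convex_on_continuous[OF open_UNIV convex_onI])
  fix t :: real and g1 g2 :: "real^'n" assume t: "0 < t" "t < 1"
  obtain x1 where x1: "x1 \<in> X" "reg_max \<Lambda> g1 x1 = saddle_value \<Lambda> g1"
    using reg_max_attains_min[OF \<Lambda>] by metis
  obtain x2 where x2: "x2 \<in> X" "reg_max \<Lambda> g2 x2 = saddle_value \<Lambda> g2"
    using reg_max_attains_min[OF \<Lambda>] by metis
  have "(1 - t) *\<^sub>R x1 + t *\<^sub>R x2 \<in> X"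
    using convexD_alt[OF convex_X x1(1) x2(1)] t by auto
  then have "saddle_value \<Lambda> ((1 - t) *\<^sub>R g1 + t *\<^sub>R g2)
      \<le> reg_max \<Lambda> ((1 - t) *\<^sub>R g1 + t *\<^sub>R g2) ((1 - t) *\<^sub>R x1 + t *\<^sub>R x2)"
    by (rule saddle_value_le[OF \<Lambda>])
  also have "\<dots> \<le> (1 - t) * reg_max \<Lambda> g1 x1 + t * reg_max \<Lambda> g2 x2"
    using t by (intro reg_max_convex[OF \<Lambda>]) auto
  finally show "saddle_value \<Lambda> ((1 - t) *\<^sub>R g1 + t *\<^sub>R g2)
      \<le> (1 - t) * saddle_value \<Lambda> g1 + t * saddle_value \<Lambda> g2"
    by (simp add: x1 x2)
qed simp

text \<open>The saddle point is the best response to a minimizer \<open>x0\<close> of the inner maximum.  Move from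
  \<open>x0\<close> a fraction \<open>t\<close> of the way to an arbitrary \<open>x \<in> X\<close>, and let \<open>w t\<close> be the best response there.
  Minimality of \<open>x0\<close> and convexity in \<open>x\<close> show that \<open>w t\<close> yields at least the value of the game
  against \<open>x\<close>, and that \<open>w t\<close> is an almost optimal response to \<open>x0\<close>.  By quadratic growth \<open>w t\<close>
  tends to the best response to \<open>x0\<close> as \<open>t\<close> tends to \<open>0\<close>, which inherits the bound against \<open>x\<close>.\<close>

lemma saddle_point_exists:
  assumes \<Lambda>: "\<Lambda> > 0"
  shows "\<exists>z. z \<in> Y \<and> (\<forall>x\<in>X. saddle_value \<Lambda> g \<le> reg_payoff \<Lambda> g x z)"
proof -
  obtain x0 where x0: "x0 \<in> X" "reg_max \<Lambda> g x0 = saddle_value \<Lambda> g"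
    using reg_max_attains_min[OF \<Lambda>] by metis
  obtain c where c: "c > 0" "\<And>\<Lambda> g x v. \<Lambda> > 0 \<Longrightarrow> v \<in> Y \<Longrightarrow>
    reg_payoff \<Lambda> g x v + \<Lambda> * c * (norm (v - response \<Lambda> g x))\<^sup>2 \<le> reg_max \<Lambda> g x"
    using response_quadratic_growth by blast
  let ?z = "response \<Lambda> g x0"
  have "saddle_value \<Lambda> g \<le> reg_payoff \<Lambda> g x ?z" if x: "x \<in> X" for x
  proof -
    define w where "w t = response \<Lambda> g ((1 - t) *\<^sub>R x0 + t *\<^sub>R x)" for t
    define D where "D = reg_max \<Lambda> g x - saddle_value \<Lambda> g"
    have ev: "\<forall>\<^sub>F t::real in at_right 0. t \<in> {0<..<1}"
      by (rule eventually_at_right_real) simp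
    have wY: "w t \<in> Y" for t
      by (simp add: w_def response_in_Y[OF \<Lambda>])
    have key: "saddle_value \<Lambda> g \<le> (1 - t) * reg_payoff \<Lambda> g x0 (w t) + t * reg_payoff \<Lambda> g x (w t)"
      if t: "t \<in> {0<..<1}" for t
    proof -
      have "(1 - t) *\<^sub>R x0 + t *\<^sub>R x \<in> X"
        using convexD_alt[OF convex_X x0(1) x] t by auto
      then have "saddle_value \<Lambda> g \<le> reg_payoff \<Lambda> g ((1 - t) *\<^sub>R x0 + t *\<^sub>R x) (w t)"
        using saddle_value_le[OF \<Lambda>] by (simp add: w_def reg_max_eq[OF \<Lambda>])
      also have "\<dots> \<le> (1 - t) * reg_payoff \<Lambda> g x0 (w t) + t * reg_payoff \<Lambda> g x (w t)"
        using t reg_payoff_convex[of t \<Lambda> g g x0 x "w t"] by (simp flip: scaleR_left_distrib)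
      finally show ?thesis .
    qed
    have low: "saddle_value \<Lambda> g \<le> reg_payoff \<Lambda> g x (w t)" if t: "t \<in> {0<..<1}" for t
    proof -
      have "(1 - t) * reg_payoff \<Lambda> g x0 (w t) \<le> (1 - t) * saddle_value \<Lambda> g"
        using reg_payoff_le_max[OF \<Lambda> wY] t unfolding x0(2)[symmetric] by (intro mult_left_mono) auto
      with key[OF t] have "t * saddle_value \<Lambda> g \<le> t * reg_payoff \<Lambda> g x (w t)"
        by (simp add: algebra_simps)
      then show ?thesis
        using t by simp
    qed
    have close: "(norm (w t - ?z))\<^sup>2 \<le> t * D / ((1 - t) * (\<Lambda> * c))" if t: "t \<in> {0<..<1}" for t
    proof -
      have "\<Lambda> * c * (norm (w t - ?z))\<^sup>2 \<le> saddle_value \<Lambda> g - reg_payoff \<Lambda> g x0 (w t)"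
        using c(2)[OF \<Lambda> wY[of t], of g x0] by (simp add: x0)
      then have "(1 - t) * (\<Lambda> * c * (norm (w t - ?z))\<^sup>2)
          \<le> (1 - t) * (saddle_value \<Lambda> g - reg_payoff \<Lambda> g x0 (w t))"
        using t by (intro mult_left_mono) auto
      also have "\<dots> \<le> t * (reg_payoff \<Lambda> g x (w t) - saddle_value \<Lambda> g)"
        using key[OF t] by (simp add: algebra_simps)
      also have "\<dots> \<le> t * D"
        using t reg_payoff_le_max[OF \<Lambda> wY] by (intro mult_left_mono) (auto simp: D_def)
      finally show ?thesis
        using t \<Lambda> c by (simp add: pos_le_divide_eq mult_ac)
    qed
    have "((\<lambda>t. (norm (w t - ?z))\<^sup>2) \<longlongrightarrow> 0) (at_right 0)"
    proof (rule tendsto_sandwich[where f = "\<lambda>_. 0"])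
      show "((\<lambda>t. t * D / ((1 - t) * (\<Lambda> * c))) \<longlongrightarrow> 0) (at_right 0)"
        using \<Lambda> c by (auto intro!: tendsto_eq_intros)
      show "\<forall>\<^sub>F t in at_right 0. (norm (w t - ?z))\<^sup>2 \<le> t * D / ((1 - t) * (\<Lambda> * c))"
        using ev by eventually_elim (rule close)
    qed auto
    then have "(w \<longlongrightarrow> ?z) (at_right 0)"
      by (simp add: LIM_zero_iff tendsto_norm_zero_iff)
    then have "((\<lambda>t. reg_payoff \<Lambda> g x (w t)) \<longlongrightarrow> reg_payoff \<Lambda> g x ?z) (at_right 0)"
      by (rule continuous_on_tendsto_compose[OF continuous_reg_payoff])
        (simp_all add: wY response_in_Y[OF \<Lambda>])
    then show ?thesis
      by (rule tendsto_lowerbound) (use ev low in \<open>auto elim: eventually_mono\<close>)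
  qed
  then show ?thesis
    using response_in_Y[OF \<Lambda>] by blast
qed

definition dual_opt :: "real \<Rightarrow> real^'n \<Rightarrow> real^'n" where
  "dual_opt \<Lambda> g = (SOME z. z \<in> Y \<and> (\<forall>x\<in>X. saddle_value \<Lambda> g \<le> reg_payoff \<Lambda> g x z))"

lemma
  assumes "\<Lambda> > 0"
  shows dual_opt_in_Y: "dual_opt \<Lambda> g \<in> Y"
    and saddle_value_le_dual_opt: "x \<in> X \<Longrightarrow> saddle_value \<Lambda> g \<le> reg_payoff \<Lambda> g x (dual_opt \<Lambda> g)"
  using someI_ex[OF saddle_point_exists[OF assms, of g]] by (auto simp: dual_opt_def)

text \<open>One half of minimax duality is the choice of \<open>dual_opt\<close>, the other is weak duality.\<close>

lemma dual_opt_maximizes: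
  assumes \<Lambda>: "\<Lambda> > 0" and v: "v \<in> Y"
  shows "primal_min \<psi> X v + g \<bullet> v - \<Lambda> * r v
    \<le> primal_min \<psi> X (dual_opt \<Lambda> g) + g \<bullet> dual_opt \<Lambda> g - \<Lambda> * r (dual_opt \<Lambda> g)"
proof -
  obtain x0 where x0: "x0 \<in> X" "reg_max \<Lambda> g x0 = saddle_value \<Lambda> g"
    using reg_max_attains_min[OF \<Lambda>] by metis
  obtain x1 where x1: "x1 \<in> X" "primal_min \<psi> X (dual_opt \<Lambda> g) = \<psi> x1 (dual_opt \<Lambda> g)"
    by (metis psi_attains_min primal_min_eq)
  have "primal_min \<psi> X v + g \<bullet> v - \<Lambda> * r v \<le> reg_payoff \<Lambda> g x0 v"
    using primal_min_le[OF x0(1)] by (simp add: reg_payoff_def)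
  also have "\<dots> \<le> saddle_value \<Lambda> g"
    using reg_payoff_le_max[OF \<Lambda> v] x0(2) by metis
  also have "\<dots> \<le> reg_payoff \<Lambda> g x1 (dual_opt \<Lambda> g)"
    by (rule saddle_value_le_dual_opt[OF \<Lambda> x1(1)])
  finally show ?thesis
    by (simp add: reg_payoff_def x1(2))
qed

text \<open>The central estimate: an approximately optimal \<open>x\<close> has a best response that is close to the
  dual optimum, because against every \<open>x \<in> X\<close> the dual optimum already secures the value of the
  game, so that it cannot lose much against the best response.\<close>

lemma response_near_dual_opt:
  assumes "\<Lambda> > 0" "x \<in> X"
  shows "\<Lambda> * bregman r (response \<Lambda> g x) (dual_opt \<Lambda> g) \<le> reg_max \<Lambda> g x - saddle_value \<Lambda> g"
  using response_three_point[OF assms(1) dual_opt_in_Y[OF assms(1)], of g x g]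
    saddle_value_le_dual_opt[OF assms, of g] by simp

lemma measurable_reg_max:
  assumes \<Lambda>: "\<Lambda> > 0" and [measurable]: "G \<in> borel_measurable M" "Z \<in> borel_measurable M"
  shows "(\<lambda>\<omega>. reg_max \<Lambda> (G \<omega>) (Z \<omega>)) \<in> borel_measurable M"
proof -
  have "(\<lambda>\<omega>. (G \<omega>, Z \<omega>)) \<in> borel_measurable M"
    by (rule borel_measurable_Pair) measurable
  from measurable_compose[OF this borel_measurable_continuous_onI[OF continuous_reg_max[OF \<Lambda>]]]
  show ?thesis
    by simp
qed

lemma measurable_saddle_value:
  assumes \<Lambda>: "\<Lambda> > 0" and G: "G \<in> borel_measurable M"
  shows "(\<lambda>\<omega>. saddle_value \<Lambda> (G \<omega>)) \<in> borel_measurable M"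
  using measurable_compose[OF G borel_measurable_continuous_onI[OF continuous_saddle_value[OF \<Lambda>]]] .

text \<open>Envelope theorem: perturbing \<open>g\<close> by \<open>t *\<^sub>R b\<close> adds \<open>t * (v \<bullet> b)\<close> to the payoff of \<open>v\<close>.  Keeping the
  old response gives the lower bound on the slope; for the upper bound, moving the response away
  costs quadratically, and can gain at most a term of order \<open>t\<^sup>2\<close>.\<close>

lemma reg_max_slope:
  assumes \<Lambda>: "\<Lambda> > 0"
  shows "((\<lambda>t. (reg_max \<Lambda> (g + t *\<^sub>R b) x - reg_max \<Lambda> g x) / t) \<longlongrightarrow> response \<Lambda> g x \<bullet> b) (at_right 0)"
proof -
  obtain c where c: "c > 0" "\<And>\<Lambda> g x v. \<Lambda> > 0 \<Longrightarrow> v \<in> Y \<Longrightarrow>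
    reg_payoff \<Lambda> g x v + \<Lambda> * c * (norm (v - response \<Lambda> g x))\<^sup>2 \<le> reg_max \<Lambda> g x"
    using response_quadratic_growth by blast
  define a where "a = \<Lambda> * c"
  have a: "a > 0"
    using \<Lambda> c by (simp add: a_def)
  let ?z = "response \<Lambda> g x"
  let ?s = "\<lambda>t. (reg_max \<Lambda> (g + t *\<^sub>R b) x - reg_max \<Lambda> g x) / t"
  have shift: "reg_payoff \<Lambda> (g + t *\<^sub>R b) x v = reg_payoff \<Lambda> g x v + t * (v \<bullet> b)" for t v
    by (simp add: reg_payoff_def inner_add_left inner_commute[of v b])
  have bounds: "?z \<bullet> b \<le> ?s t \<and> ?s t \<le> ?z \<bullet> b + t * ((norm b)\<^sup>2 / (4 * a))" if t: "t > 0" for t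
  proof
    have "reg_max \<Lambda> g x + t * (?z \<bullet> b) \<le> reg_max \<Lambda> (g + t *\<^sub>R b) x"
      using reg_payoff_le_max[OF \<Lambda> response_in_Y[OF \<Lambda>], of "g + t *\<^sub>R b" x g x]
      by (simp add: shift reg_max_eq[OF \<Lambda>, of g x])
    then show "?z \<bullet> b \<le> ?s t"
      using t by (simp add: field_simps)
    define v where "v = response \<Lambda> (g + t *\<^sub>R b) x"
    define n where "n = norm (v - ?z)"
    have "reg_max \<Lambda> (g + t *\<^sub>R b) x = reg_payoff \<Lambda> g x v + t * (v \<bullet> b)"
      by (simp add: reg_max_eq[OF \<Lambda>, of "g + t *\<^sub>R b"] shift v_def)
    also have "\<dots> \<le> reg_max \<Lambda> g x - a * n\<^sup>2 + t * (v \<bullet> b)"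
      using c(2)[OF \<Lambda> response_in_Y[OF \<Lambda>], of g x "g + t *\<^sub>R b" x]
      by (simp add: a_def n_def v_def)
    also have "v \<bullet> b = ?z \<bullet> b + (v - ?z) \<bullet> b"
      by (simp add: inner_diff_left)
    also have "reg_max \<Lambda> g x - a * n\<^sup>2 + t * (?z \<bullet> b + (v - ?z) \<bullet> b)
        \<le> reg_max \<Lambda> g x - a * n\<^sup>2 + t * (?z \<bullet> b + n * norm b)"
      using t norm_cauchy_schwarz[of "v - ?z" b] by (simp add: n_def)
    also have "\<dots> \<le> reg_max \<Lambda> g x + t * (?z \<bullet> b + t * ((norm b)\<^sup>2 / (4 * a)))"
    proof -
      have "0 \<le> (2 * a * n - t * norm b)\<^sup>2 / (4 * a)"
        using a by simp
      also have "\<dots> = a * n\<^sup>2 - t * (n * norm b) + t * (t * ((norm b)\<^sup>2 / (4 * a)))"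
        using a by (simp add: power2_eq_square field_simps)
      finally show ?thesis
        by (simp add: algebra_simps)
    qed
    finally show "?s t \<le> ?z \<bullet> b + t * ((norm b)\<^sup>2 / (4 * a))"
      using t by (simp add: pos_divide_le_eq mult.commute)
  qed
  have ev: "\<forall>\<^sub>F t::real in at_right 0. t > 0"
    by (rule eventually_at_right_less)
  show ?thesis
  proof (rule tendsto_sandwich[where f = "\<lambda>_. ?z \<bullet> b"])
    show "((\<lambda>t. ?z \<bullet> b + t * ((norm b)\<^sup>2 / (4 * a))) \<longlongrightarrow> ?z \<bullet> b) (at_right 0)"
      using a by (auto intro!: tendsto_eq_intros)
    show "\<forall>\<^sub>F t in at_right 0. ?z \<bullet> b \<le> ?s t"
      using ev by eventually_elim (use bounds in blast)
    show "\<forall>\<^sub>F t in at_right 0. ?s t \<le> ?z \<bullet> b + t * ((norm b)\<^sup>2 / (4 * a))"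
      using ev by eventually_elim (use bounds in blast)
  qed (rule tendsto_const)
qed

lemma measurable_response:
  assumes \<Lambda>: "\<Lambda> > 0" and [measurable]: "G \<in> borel_measurable M" "Z \<in> borel_measurable M"
  shows "(\<lambda>\<omega>. response \<Lambda> (G \<omega>) (Z \<omega>)) \<in> borel_measurable M"
proof -
  have "(\<lambda>\<omega>. response \<Lambda> (G \<omega>) (Z \<omega>) \<bullet> b) \<in> borel_measurable M" for b
  proof (rule borel_measurable_LIMSEQ_real)
    let ?t = "\<lambda>n. 1 / real (Suc n)"
    show "(\<lambda>\<omega>. (reg_max \<Lambda> (G \<omega> + ?t n *\<^sub>R b) (Z \<omega>) - reg_max \<Lambda> (G \<omega>) (Z \<omega>)) / ?t n)
        \<in> borel_measurable M" for n
      by (intro borel_measurable_divide borel_measurable_diff measurable_reg_max[OF \<Lambda>]) measurable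
    have "filterlim ?t (at_right 0) sequentially"
      using LIMSEQ_Suc[OF lim_1_over_n] by (auto simp: filterlim_at eventually_sequentially)
    from filterlim_compose[OF reg_max_slope[OF \<Lambda>] this]
    show "(\<lambda>n. (reg_max \<Lambda> (G \<omega> + ?t n *\<^sub>R b) (Z \<omega>) - reg_max \<Lambda> (G \<omega>) (Z \<omega>)) / ?t n)
        \<longlonglongrightarrow> response \<Lambda> (G \<omega>) (Z \<omega>) \<bullet> b" for \<omega> .
  qed
  then show ?thesis
    by (subst borel_measurable_euclidean_space) auto
qed

text \<open>By first-order optimality of \<open>q\<close> the vector \<open>g - \<Lambda> *\<^sub>R grad r q\<close> is normal to \<open>U\<close> at \<open>q\<close>.  The
  setup requires such vectors to be constant on \<open>Y\<close>, so that there the linear terms \<open>g \<bullet> v\<close> and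
  \<open>\<Lambda> * (grad r q \<bullet> v)\<close> are interchangeable.\<close>

lemma bregman_center_shift:
  assumes \<Lambda>: "\<Lambda> > 0" and q: "q \<in> U" "\<And>v. v \<in> U \<Longrightarrow> \<Lambda> * r q - g \<bullet> q \<le> \<Lambda> * r v - g \<bullet> v"
  obtains c where "\<And>x v. v \<in> Y \<Longrightarrow> \<psi> x v - \<Lambda> * bregman r q v = reg_payoff \<Lambda> g x v + c"
proof -
  have conc: "concave_on U ((\<bullet>) g)"
    unfolding concave_on_def convex_on_def using convex_U by (simp add: inner_add_right)
  have max: "g \<bullet> v - \<Lambda> * r v \<le> g \<bullet> q - \<Lambda> * r q" if "v \<in> U" for v
    using q(2)[OF that] by simp
  obtain p where "p \<in> U \<inter> interior P"
    using U_interior by auto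
  then have int: "q \<in> interior P"
    using regularized_maximizer_interior[OF convex_U _ _ q(1) conc \<Lambda> max] by blast
  define w where "w = g - \<Lambda> *\<^sub>R grad r q"
  have "w \<bullet> (v - q) \<le> 0" if "v \<in> U" for v
    using regularized_maximizer_first_order[OF convex_U U_subset_P _ that conc \<Lambda> max] q int
    by (simp add: w_def inner_diff_left inner_diff_right algebra_simps)
  then have "w \<in> subdifferential (indicator_ext U) q"
    using q(1) by (auto simp: subdifferential_def indicator_ext_def)
  then have "(\<lambda>y. w \<bullet> y) constant_on Y"
    using normal_constant int q by blast
  then obtain c where c: "\<And>v. v \<in> Y \<Longrightarrow> w \<bullet> v = c"
    by (auto simp: constant_on_def)
  show thesis
  proof (rule that)
    fix x v assume "v \<in> Y"
    from c[OF this] have "\<Lambda> * (grad r q \<bullet> v) = g \<bullet> v - c"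
      by (simp add: w_def inner_diff_left)
    then show "\<psi> x v - \<Lambda> * bregman r q v
        = reg_payoff \<Lambda> g x v + (\<Lambda> * r q - \<Lambda> * (grad r q \<bullet> q) - c)"
      by (simp add: bregman_def reg_payoff_def inner_diff_right algebra_simps)
  qed
qed

text \<open>The constant by which the two payoffs differ depends on neither \<open>x\<close> nor \<open>v\<close>, so that it cancels
  in the primal gap and does not affect best responses.\<close>

lemma
  assumes \<Lambda>: "\<Lambda> > 0" and q: "q \<in> U" "\<And>v. v \<in> U \<Longrightarrow> \<Lambda> * r q - g \<bullet> q \<le> \<Lambda> * r v - g \<bullet> v"
  shows dual_reg_gap: "dual_reg \<psi> Y r \<Lambda> q x - (INF x'\<in>X. dual_reg \<psi> Y r \<Lambda> q x')
      = reg_max \<Lambda> g x - saddle_value \<Lambda> g"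
    and best_response_eq: "is_arg_max (\<lambda>v. \<psi> x v - \<Lambda> * bregman r q v) (\<lambda>v. v \<in> Y) y
      \<Longrightarrow> y = response \<Lambda> g x"
proof -
  obtain c where c: "\<And>x v. v \<in> Y \<Longrightarrow> \<psi> x v - \<Lambda> * bregman r q v = reg_payoff \<Lambda> g x v + c"
    using bregman_center_shift[OF assms] by blast
  have eq: "dual_reg \<psi> Y r \<Lambda> q x = reg_max \<Lambda> g x + c" for x
    unfolding dual_reg_def reg_max_eq[OF \<Lambda>]
    using reg_payoff_le_response[OF \<Lambda>] response_in_Y[OF \<Lambda>] c
    by (intro cSup_eq_maximum) (auto intro!: image_eqI[of _ _ "response \<Lambda> g x"])
  obtain x0 where x0: "x0 \<in> X" "reg_max \<Lambda> g x0 = saddle_value \<Lambda> g"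
    "\<And>x'. x' \<in> X \<Longrightarrow> saddle_value \<Lambda> g \<le> reg_max \<Lambda> g x'"
    using reg_max_attains_min[OF \<Lambda>] by metis
  have "(INF x'\<in>X. dual_reg \<psi> Y r \<Lambda> q x') = saddle_value \<Lambda> g + c"
    unfolding eq using x0 by (intro cInf_eq_minimum) (auto intro!: image_eqI[of _ _ x0])
  then show "dual_reg \<psi> Y r \<Lambda> q x - (INF x'\<in>X. dual_reg \<psi> Y r \<Lambda> q x')
      = reg_max \<Lambda> g x - saddle_value \<Lambda> g"
    by (simp add: eq)
  assume "is_arg_max (\<lambda>v. \<psi> x v - \<Lambda> * bregman r q v) (\<lambda>v. v \<in> Y) y"
  then show "y = response \<Lambda> g x"
    using c by (intro response_unique[OF \<Lambda>]) (auto simp: is_arg_max_def not_less)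
qed

end

section \<open>Runs of the framework with general weights\<close>

locale extraction_process = dual_extraction \<psi> X Y U P N r \<mu>
  for \<psi> :: "real^'d \<Rightarrow> real^'n \<Rightarrow> real" and X Y U P N r \<mu> +
  fixes y0 :: "real^'n" and K :: nat and l e :: "nat \<Rightarrow> real" and M :: "'w measure"
    and x :: "nat \<Rightarrow> 'w \<Rightarrow> real^'d" and q y :: "nat \<Rightarrow> 'w \<Rightarrow> real^'n"
  assumes run: "dual_extraction_run \<psi> X Y U r y0 K l e M x q y"
    and y0: "y0 \<in> Y \<inter> interior P"
    and weights_pos: "\<And>k. l k > 0"
    and accuracies_nonneg: "\<And>k. e k \<ge> 0"
begin

sublocale prob_space M
  using run by (simp add: dual_extraction_run_def)

definition cum_weight :: "nat \<Rightarrow> real" where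
  "cum_weight k = (\<Sum>j<k. l j)"

text \<open>The parameter \<open>g\<close> of the regularized game of round \<open>k\<close>.\<close>

definition tilt :: "nat \<Rightarrow> 'w \<Rightarrow> real^'n" where
  "tilt k \<omega> = (\<Sum>j<k. l j *\<^sub>R grad r (y j \<omega>))"

definition gap :: "nat \<Rightarrow> 'w \<Rightarrow> real" where
  "gap k \<omega> = reg_max (cum_weight k) (tilt k \<omega>) (x k \<omega>) - saddle_value (cum_weight k) (tilt k \<omega>)"

definition opt :: "nat \<Rightarrow> 'w \<Rightarrow> real^'n" where
  "opt k \<omega> = dual_opt (cum_weight k) (tilt k \<omega>)"

lemma cum_weight_pos: "k \<ge> 1 \<Longrightarrow> cum_weight k > 0"
  unfolding cum_weight_def by (intro sum_pos) (auto simp: weights_pos lessThan_empty_iff)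

lemma
  assumes "k \<in> {1..K}"
  shows x_measurable: "x k \<in> borel_measurable M"
    and x_in_X: "\<omega> \<in> space M \<Longrightarrow> x k \<omega> \<in> X"
    and drpo_accuracy: "AE \<omega> in M. nn_cond_exp M (past M x k) (\<lambda>\<omega>.
        ennreal (dual_reg \<psi> Y r (cum_weight k) (q k \<omega>) (x k \<omega>)
          - (INF x'\<in>X. dual_reg \<psi> Y r (cum_weight k) (q k \<omega>) x'))) \<omega> \<le> ennreal (e k)"
    and q_arg_min: "\<omega> \<in> space M \<Longrightarrow>
      is_arg_min (\<lambda>v. 1 / cum_weight k * (\<Sum>j<k. l j * bregman r (y j \<omega>) v)) (\<lambda>v. v \<in> U) (q k \<omega>)"
    and y_arg_max: "\<omega> \<in> space M \<Longrightarrow>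
      is_arg_max (\<lambda>v. \<psi> (x k \<omega>) v - cum_weight k * bregman r (q k \<omega>) v) (\<lambda>v. v \<in> Y) (y k \<omega>)"
    and y_zero: "\<omega> \<in> space M \<Longrightarrow> y 0 \<omega> = y0"
  using run assms unfolding dual_extraction_run_def DRPO_output_def cum_weight_def by blast+

lemma sum_bregman_eq:
  "(\<Sum>j<k. l j * bregman r (y j \<omega>) v)
    = cum_weight k * r v - tilt k \<omega> \<bullet> v + (\<Sum>j<k. l j * (grad r (y j \<omega>) \<bullet> y j \<omega> - r (y j \<omega>)))"
  by (simp add: cum_weight_def tilt_def bregman_def inner_sum_left inner_diff_right sum_distrib_left sum_distrib_right
      algebra_simps sum_subtractf sum.distrib)

lemma q_minimizes:
  assumes k: "k \<in> {1..K}" and \<omega>: "\<omega> \<in> space M"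
  shows "q k \<omega> \<in> U"
    and "v \<in> U \<Longrightarrow> cum_weight k * r (q k \<omega>) - tilt k \<omega> \<bullet> q k \<omega> \<le> cum_weight k * r v - tilt k \<omega> \<bullet> v"
proof -
  have "cum_weight k > 0"
    using cum_weight_pos k by simp
  with q_arg_min[OF k \<omega>] show "q k \<omega> \<in> U"
    "v \<in> U \<Longrightarrow> cum_weight k * r (q k \<omega>) - tilt k \<omega> \<bullet> q k \<omega> \<le> cum_weight k * r v - tilt k \<omega> \<bullet> v"
    by (auto simp: is_arg_min_def not_less sum_bregman_eq divide_le_cancel)
qed

lemma y_eq_response:
  assumes k: "k \<in> {1..K}" and \<omega>: "\<omega> \<in> space M"
  shows "y k \<omega> = response (cum_weight k) (tilt k \<omega>) (x k \<omega>)"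
  using best_response_eq[OF _ q_minimizes[OF k \<omega>] y_arg_max[OF k \<omega>]] cum_weight_pos k by simp

lemma drpo_gap_eq:
  assumes k: "k \<in> {1..K}" and \<omega>: "\<omega> \<in> space M"
  shows "dual_reg \<psi> Y r (cum_weight k) (q k \<omega>) (x k \<omega>)
      - (INF x'\<in>X. dual_reg \<psi> Y r (cum_weight k) (q k \<omega>) x') = gap k \<omega>"
  using dual_reg_gap[OF _ q_minimizes[OF k \<omega>]] cum_weight_pos k by (simp add: gap_def)

lemma y_in:
  assumes "k \<le> K" "K \<ge> 1" "\<omega> \<in> space M"
  shows "y k \<omega> \<in> Y \<inter> interior P"
proof (cases "k = 0")
  case True
  then show ?thesis
    using y_zero[of 1] y0 assms by simp
next
  case False
  then have "k \<in> {1..K}" "cum_weight k > 0"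
    using assms cum_weight_pos by auto
  then show ?thesis
    using assms by (simp add: y_eq_response response_in_Y response_interior)
qed

text \<open>Strong induction over the rounds: \<open>y k\<close> is a measurable function of \<open>x k\<close> and of the gradients at
  the earlier \<open>y j\<close>.\<close>

lemma y_measurable:
  assumes "K \<ge> 1" "k \<le> K"
  shows "y k \<in> borel_measurable M"
  using assms(2)
proof (induction k rule: less_induct)
  case (less k)
  show ?case
  proof (cases "k = 0")
    case True
    have "y k \<in> borel_measurable M \<longleftrightarrow> (\<lambda>_. y0) \<in> borel_measurable M"
      using True y_zero[of 1] assms(1) by (intro measurable_cong) auto
    then show ?thesis by simp
  next
    case False
    then have k: "k \<in> {1..K}" and pos: "cum_weight k > 0"
      using less.prems cum_weight_pos by auto
    have "tilt k \<in> borel_measurable M"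
      unfolding tilt_def using less.IH less.prems y_in assms(1)
      by (intro borel_measurable_sum borel_measurable_scaleR borel_measurable_const
          measurable_grad_comp) auto
    then have "(\<lambda>\<omega>. response (cum_weight k) (tilt k \<omega>) (x k \<omega>)) \<in> borel_measurable M"
      by (intro measurable_response[OF pos] x_measurable[OF k])
    then show ?thesis
      using y_eq_response[OF k] by (subst measurable_cong) auto
  qed
qed

lemma tilt_measurable:
  assumes "K \<ge> 1" "k \<le> K"
  shows "tilt k \<in> borel_measurable M"
  unfolding tilt_def using y_measurable y_in assms
  by (intro borel_measurable_sum borel_measurable_scaleR borel_measurable_const
      measurable_grad_comp) auto

lemma gap_measurable: "k \<in> {1..K} \<Longrightarrow> gap k \<in> borel_measurable M"
  unfolding gap_def
  by (intro borel_measurable_diff measurable_reg_max measurable_saddle_value cum_weight_pos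
      tilt_measurable x_measurable) auto

lemma gap_nonneg:
  assumes "k \<in> {1..K}" "\<omega> \<in> space M"
  shows "gap k \<omega> \<ge> 0"
  unfolding gap_def using saddle_value_le[OF _ x_in_X[OF assms]] cum_weight_pos assms by simp

lemma subalgebra_past:
  assumes "k \<le> K"
  shows "subalgebra M (past M x k)"
  unfolding subalgebra_def past_def
proof
  let ?A = "\<Union>j\<in>{1..<k}. {x j -` A \<inter> space M | A. A \<in> sets borel}"
  show "space (sigma (space M) ?A) = space M"
    by (simp add: space_measure_of_conv)
  have "?A \<subseteq> sets M"
    using x_measurable assms by (auto intro!: measurable_sets[where A = borel])
  moreover have "?A \<subseteq> Pow (space M)"
    by auto
  ultimately show "sets (sigma (space M) ?A) \<subseteq> sets M"
    by (simp add: sets.sigma_sets_subset)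
qed

text \<open>Integrating the conditional guarantee; only its mean matters below, because the pathwise bounds
  are linear in the gaps.\<close>

lemma
  assumes k: "k \<in> {1..K}"
  shows gap_integrable: "integrable M (gap k)" and expectation_gap_le: "expectation (gap k) \<le> e k"
proof -
  interpret F: finite_measure_subalgebra M "past M x k"
    using k by unfold_locales (auto intro: subalgebra_past)
  let ?f = "\<lambda>\<omega>. ennreal (dual_reg \<psi> Y r (cum_weight k) (q k \<omega>) (x k \<omega>)
      - (INF x'\<in>X. dual_reg \<psi> Y r (cum_weight k) (q k \<omega>) x'))"
  have f: "?f \<omega> = ennreal (gap k \<omega>)" if "\<omega> \<in> space M" for \<omega>
    using drpo_gap_eq[OF k that] by simp
  have "?f \<in> borel_measurable M \<longleftrightarrow> (\<lambda>\<omega>. ennreal (gap k \<omega>)) \<in> borel_measurable M"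
    by (intro measurable_cong f)
  then have meas: "?f \<in> borel_measurable M"
    using gap_measurable[OF k] by simp
  have "(\<integral>\<^sup>+\<omega>. ennreal (gap k \<omega>) \<partial>M) = (\<integral>\<^sup>+\<omega>. 1 * ?f \<omega> \<partial>M)"
    by (intro nn_integral_cong) (simp add: f)
  also have "\<dots> = (\<integral>\<^sup>+\<omega>. 1 * nn_cond_exp M (past M x k) ?f \<omega> \<partial>M)"
    by (intro F.nn_cond_exp_intg[symmetric] meas) simp
  also have "\<dots> \<le> (\<integral>\<^sup>+\<omega>. ennreal (e k) \<partial>M)"
    using drpo_accuracy[OF k] by (intro nn_integral_mono_AE) simp
  also have "\<dots> = ennreal (e k)"
    by (simp add: emeasure_space_1)
  finally have le: "(\<integral>\<^sup>+\<omega>. ennreal (gap k \<omega>) \<partial>M) \<le> ennreal (e k)" .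
  have nonneg: "AE \<omega> in M. 0 \<le> gap k \<omega>"
    using gap_nonneg[OF k] by simp
  show int: "integrable M (gap k)"
    using le by (intro integrableI_nonneg gap_measurable[OF k] nonneg) (auto simp: le_less_trans)
  have "ennreal (expectation (gap k)) \<le> ennreal (e k)"
    using nn_integral_eq_integral[OF int nonneg] le by simp
  then show "expectation (gap k) \<le> e k"
    using accuracies_nonneg by (simp add: ennreal_le_iff)
qed

lemma bregman_opt_le_gap:
  assumes k: "k \<in> {1..K}" and \<omega>: "\<omega> \<in> space M"
  shows "bregman r (y k \<omega>) (opt k \<omega>) \<le> gap k \<omega> / cum_weight k"
  using response_near_dual_opt[OF _ x_in_X[OF k \<omega>], of "cum_weight k" "tilt k \<omega>"] cum_weight_pos[of k] k
  by (simp add: opt_def gap_def y_eq_response[OF k \<omega>] field_simps)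

lemma opt_in_Y: "k \<ge> 1 \<Longrightarrow> opt k \<omega> \<in> Y"
  by (simp add: opt_def dual_opt_in_Y cum_weight_pos)

lemma opt_maximizes:
  assumes "k \<ge> 1" "v \<in> Y"
  shows "primal_min \<psi> X v - (\<Sum>j<k. l j * bregman r (y j \<omega>) v)
    \<le> primal_min \<psi> X (opt k \<omega>) - (\<Sum>j<k. l j * bregman r (y j \<omega>) (opt k \<omega>))"
  using dual_opt_maximizes[OF cum_weight_pos[OF assms(1)] assms(2), of "tilt k \<omega>"]
  by (simp add: sum_bregman_eq opt_def)

text \<open>The optimum of round \<open>k\<close> is a candidate in round \<open>k + 1\<close>.  There it pays one additional penalty,
  the divergence from \<open>y k\<close>, which the gap of round \<open>k\<close> controls.\<close>

lemma opt_value_telescope: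
  assumes "k \<ge> 1" "k \<le> K" and \<omega>: "\<omega> \<in> space M" and v: "v \<in> Y"
  shows "primal_min \<psi> X v - l 0 * bregman r y0 v \<le>
    primal_min \<psi> X (opt k \<omega>) - (\<Sum>j<k. l j * bregman r (y j \<omega>) (opt k \<omega>))
      + (\<Sum>j=1..<k. l j / cum_weight j * gap j \<omega>)"
  using assms(1,2)
proof (induction k rule: dec_induct)
  case base
  show ?case
    using opt_maximizes[of 1 v \<omega>] y_zero[of 1 \<omega>] base v \<omega> by simp
next
  case (step k)
  then have k: "k \<in> {1..K}" by simp
  have "l k * bregman r (y k \<omega>) (opt k \<omega>) \<le> l k / cum_weight k * gap k \<omega>"
    using mult_left_mono[OF bregman_opt_le_gap[OF k \<omega>], of "l k"] weights_pos[of k] by simp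
  moreover have "primal_min \<psi> X (opt k \<omega>) - (\<Sum>j<Suc k. l j * bregman r (y j \<omega>) (opt k \<omega>))
    \<le> primal_min \<psi> X (opt (Suc k) \<omega>) - (\<Sum>j<Suc k. l j * bregman r (y j \<omega>) (opt (Suc k) \<omega>))"
    using step by (intro opt_maximizes opt_in_Y) auto
  ultimately show ?case
    using step by simp
qed

lemma norm_sub_opt_le:
  assumes k: "k \<in> {1..K}" and \<omega>: "\<omega> \<in> space M"
  shows "(N (opt k \<omega> - y k \<omega>))\<^sup>2 \<le> 2 / (\<mu> * cum_weight k) * gap k \<omega>"
proof -
  have "\<mu> / 2 * (N (opt k \<omega> - y k \<omega>))\<^sup>2 \<le> bregman r (y k \<omega>) (opt k \<omega>)"
    using y_in[of k \<omega>] opt_in_Y[of k \<omega>] k \<omega> Y_subset_U by (intro bregman_strongly_convex) auto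
  also have "\<dots> \<le> gap k \<omega> / cum_weight k"
    by (rule bregman_opt_le_gap[OF assms])
  finally show ?thesis
    using mu_pos cum_weight_pos[of k] k by (simp add: field_simps)
qed

text \<open>The Lipschitz term \<open>L * N (opt K \<omega> - y K \<omega>)\<close> is of the order of the square root of the gap.  Young's
  inequality with parameter \<open>\<eta>\<close> makes it linear in the gap, so that taking expectations needs no
  further convexity argument.\<close>

lemma suboptimality_pathwise:
  assumes K: "K \<ge> 1" and \<omega>: "\<omega> \<in> space M" and v: "v \<in> Y"
    and Lip: "\<And>u w. u \<in> Y \<Longrightarrow> w \<in> Y \<Longrightarrow> \<bar>primal_min \<psi> X u - primal_min \<psi> X w\<bar> \<le> L * N (u - w)"
    and \<eta>: "\<eta> > 0"
  shows "primal_min \<psi> X v - primal_min \<psi> X (y K \<omega>) \<le> l 0 * bregman r y0 v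
    + (\<Sum>j=1..<K. l j / cum_weight j * gap j \<omega>) + (\<eta> + L\<^sup>2 / (2 * \<eta> * \<mu> * cum_weight K) * gap K \<omega>)"
proof -
  have "(\<Sum>j<K. l j * bregman r (y j \<omega>) (opt K \<omega>)) \<ge> 0"
    using y_in[OF _ K \<omega>] opt_in_Y[OF K] Y_subset_P weights_pos
    by (intro sum_nonneg mult_nonneg_nonneg bregman_nonneg) (auto simp: less_imp_le)
  with opt_value_telescope[OF K order_refl \<omega> v]
  have "primal_min \<psi> X v \<le> primal_min \<psi> X (opt K \<omega>) + l 0 * bregman r y0 v
      + (\<Sum>j=1..<K. l j / cum_weight j * gap j \<omega>)"
    by linarith
  moreover define s where "s = N (opt K \<omega> - y K \<omega>)"
  have "primal_min \<psi> X (opt K \<omega>) - primal_min \<psi> X (y K \<omega>) \<le> L * s"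
    using Lip[OF opt_in_Y[OF K], of "y K \<omega>" \<omega>] y_in[OF _ K \<omega>, of K] by (auto simp: s_def)
  moreover have "L * s \<le> \<eta> + L\<^sup>2 / (2 * \<eta> * \<mu> * cum_weight K) * gap K \<omega>"
  proof -
    have "0 \<le> (2 * \<eta> - L * s)\<^sup>2 / (4 * \<eta>)"
      using \<eta> by simp
    also have "\<dots> = \<eta> + L\<^sup>2 / (4 * \<eta>) * s\<^sup>2 - L * s"
      using \<eta> by (simp add: power2_eq_square field_simps)
    finally have "L * s \<le> \<eta> + L\<^sup>2 / (4 * \<eta>) * s\<^sup>2"
      by simp
    also have "\<dots> \<le> \<eta> + L\<^sup>2 / (4 * \<eta>) * (2 / (\<mu> * cum_weight K) * gap K \<omega>)"
      using norm_sub_opt_le[of K \<omega>] K \<omega> \<eta> unfolding s_def by (intro add_left_mono mult_left_mono) auto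
    also have "L\<^sup>2 / (4 * \<eta>) * (2 / (\<mu> * cum_weight K) * gap K \<omega>)
        = L\<^sup>2 / (2 * \<eta> * \<mu> * cum_weight K) * gap K \<omega>"
      by (simp add: field_simps)
    finally show ?thesis .
  qed
  ultimately show ?thesis
    by linarith
qed

text \<open>Integrability of the output value comes for free: the suboptimality is nonnegative, as \<open>v\<close> is a
  maximizer, and it is dominated by a linear combination of integrable gaps.\<close>

theorem expected_suboptimality:
  assumes K: "K \<ge> 1" and v: "v \<in> Y" "\<And>w. w \<in> Y \<Longrightarrow> primal_min \<psi> X w \<le> primal_min \<psi> X v"
    and Lip: "\<And>u w. u \<in> Y \<Longrightarrow> w \<in> Y \<Longrightarrow> \<bar>primal_min \<psi> X u - primal_min \<psi> X w\<bar> \<le> L * N (u - w)"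
    and \<eta>: "\<eta> > 0"
  shows "integrable M (\<lambda>\<omega>. primal_min \<psi> X (y K \<omega>))"
    and "primal_min \<psi> X v - expectation (\<lambda>\<omega>. primal_min \<psi> X (y K \<omega>)) \<le> l 0 * bregman r y0 v
      + (\<Sum>j=1..<K. l j / cum_weight j * e j) + (\<eta> + L\<^sup>2 / (2 * \<eta> * \<mu> * cum_weight K) * e K)"
proof -
  define bound where "bound = (\<lambda>E. l 0 * bregman r y0 v + (\<Sum>j=1..<K. l j / cum_weight j * E j)
      + (\<eta> + L\<^sup>2 / (2 * \<eta> * \<mu> * cum_weight K) * E K))"
  have int_bound: "integrable M (\<lambda>\<omega>. bound (\<lambda>j. gap j \<omega>))"
    unfolding bound_def using K
    by (intro Bochner_Integration.integrable_add Bochner_Integration.integrable_sum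
        integrable_mult_right gap_integrable integrable_const) auto
  have path: "primal_min \<psi> X v - primal_min \<psi> X (y K \<omega>) \<le> bound (\<lambda>j. gap j \<omega>)" if "\<omega> \<in> space M" for \<omega>
    unfolding bound_def by (rule suboptimality_pathwise[OF K that v(1) Lip \<eta>])
  have meas: "(\<lambda>\<omega>. primal_min \<psi> X (y K \<omega>)) \<in> borel_measurable M"
    by (rule measurable_compose[OF y_measurable[OF K order_refl]
          borel_measurable_continuous_onI[OF continuous_primal_min]])
  have int_diff: "integrable M (\<lambda>\<omega>. primal_min \<psi> X v - primal_min \<psi> X (y K \<omega>))"
  proof (rule Bochner_Integration.integrable_bound[OF int_bound])
    show "(\<lambda>\<omega>. primal_min \<psi> X v - primal_min \<psi> X (y K \<omega>)) \<in> borel_measurable M"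
      using meas by measurable
    show "AE \<omega> in M. norm (primal_min \<psi> X v - primal_min \<psi> X (y K \<omega>)) \<le> norm (bound (\<lambda>j. gap j \<omega>))"
    proof (rule AE_I2)
      fix \<omega> assume \<omega>: "\<omega> \<in> space M"
      show "norm (primal_min \<psi> X v - primal_min \<psi> X (y K \<omega>)) \<le> norm (bound (\<lambda>j. gap j \<omega>))"
        using path[OF \<omega>] v(2)[of "y K \<omega>"] y_in[OF order_refl K \<omega>] by auto
    qed
  qed
  from Bochner_Integration.integrable_diff[OF integrable_const[of "primal_min \<psi> X v"] this]
  show int: "integrable M (\<lambda>\<omega>. primal_min \<psi> X (y K \<omega>))"
    by simp
  have "primal_min \<psi> X v - expectation (\<lambda>\<omega>. primal_min \<psi> X (y K \<omega>))
      = expectation (\<lambda>\<omega>. primal_min \<psi> X v - primal_min \<psi> X (y K \<omega>))"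
    using int by (simp add: prob_space)
  also have "\<dots> \<le> expectation (\<lambda>\<omega>. bound (\<lambda>j. gap j \<omega>))"
    using path by (intro integral_mono int_diff int_bound)
  also have "\<dots> = bound (\<lambda>j. expectation (gap j))"
  proof -
    define S where "S \<omega> = (\<Sum>j=1..<K. l j / cum_weight j * gap j \<omega>)" for \<omega>
    define T where "T \<omega> = L\<^sup>2 / (2 * \<eta> * \<mu> * cum_weight K) * gap K \<omega>" for \<omega>
    have int: "integrable M (\<lambda>\<omega>. l j / cum_weight j * gap j \<omega>)" if "j \<in> {1..<K}" for j
      using that by (intro integrable_mult_right gap_integrable) auto
    have "integrable M S"
      unfolding S_def by (intro Bochner_Integration.integrable_sum int)
    moreover have "expectation S = (\<Sum>j=1..<K. l j / cum_weight j * expectation (gap j))"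
      unfolding S_def by (subst Bochner_Integration.integral_sum, erule int)
        (simp only: integral_mult_right_zero)
    moreover have "integrable M T" "expectation T = L\<^sup>2 / (2 * \<eta> * \<mu> * cum_weight K) * expectation (gap K)"
      unfolding T_def using K by (auto intro!: integrable_mult_right gap_integrable)
    ultimately show ?thesis
      unfolding bound_def S_def[symmetric] T_def[symmetric] by (simp add: prob_space)
  qed
  also have "\<dots> \<le> bound e"
    unfolding bound_def using K \<eta> mu_pos
    by (intro add_mono sum_mono mult_left_mono expectation_gap_le order_refl)
      (auto intro!: divide_nonneg_nonneg mult_nonneg_nonneg simp: less_imp_le weights_pos cum_weight_pos)
  finally show "primal_min \<psi> X v - expectation (\<lambda>\<omega>. primal_min \<psi> X (y K \<omega>)) \<le> l 0 * bregman r y0 v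
      + (\<Sum>j=1..<K. l j / cum_weight j * e j) + (\<eta> + L\<^sup>2 / (2 * \<eta> * \<mu> * cum_weight K) * e K)"
    by (simp add: bound_def)
qed

end

section \<open>Geometrically growing weights\<close>

theorem corollary5:
  fixes \<psi> :: "real^'d \<Rightarrow> real^'n \<Rightarrow> real"
    and X :: "(real^'d) set" and Y U P :: "(real^'n) set"
    and N r :: "real^'n \<Rightarrow> real" and \<mu> L B \<epsilon> :: real
    and y0 ystar :: "real^'n" and K :: nat
    and M :: "'w measure"
    and x :: "nat \<Rightarrow> 'w \<Rightarrow> real^'d" and q y :: "nat \<Rightarrow> 'w \<Rightarrow> real^'n"
  assumes "dual_extraction_setup \<psi> X Y U P N r \<mu>"
    and "y0 \<in> Y \<inter> interior P"
    and "is_arg_max (primal_min \<psi> X) (\<lambda>v. v \<in> Y) ystar"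
    and "L \<ge> 0"
    and "\<forall>u\<in>Y. \<forall>v\<in>Y. \<bar>primal_min \<psi> X u - primal_min \<psi> X v\<bar> \<le> L * N (u - v)"
    and "B > 0" and "bregman r y0 ystar \<le> B"
    and "\<epsilon> > 0"
    and "real K \<ge> max (log 2 (L\<^sup>2 * B / (\<mu> * \<epsilon>\<^sup>2))) 1 + 10"
    and "dual_extraction_run \<psi> X Y U r y0 K
           (\<lambda>k. 2 ^ k * (\<epsilon> / (4 * B))) (\<lambda>k. \<epsilon> / (4 * real K)) M x q y"
  shows "integrable M (\<lambda>\<omega>. primal_min \<psi> X (y K \<omega>)) \<and>
         primal_min \<psi> X ystar - (\<integral>\<omega>. primal_min \<psi> X (y K \<omega>) \<partial>M) \<le> \<epsilon>"
proof -
  define l where "l = (\<lambda>k::nat. 2 ^ k * (\<epsilon> / (4 * B)))"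
  define e where "e = (\<lambda>k::nat. \<epsilon> / (4 * real K))"
  define R where "R = L\<^sup>2 * B / (\<mu> * \<epsilon>\<^sup>2)"
  have K: "real K \<ge> log 2 R + 10" "K \<ge> 11"
    using assms(9) by (auto simp: R_def)
  interpret extraction_process \<psi> X Y U P N r \<mu> y0 K l e M x q y
    using assms by unfold_locales (auto simp: l_def e_def)
  note \<mu> = mu_pos
  have ystar: "ystar \<in> Y" "\<And>w. w \<in> Y \<Longrightarrow> primal_min \<psi> X w \<le> primal_min \<psi> X ystar"
    using assms(3) by (auto simp: is_arg_max_def not_less)
  have cum: "cum_weight k = (2 ^ k - 1) * (\<epsilon> / (4 * B))" for k
  proof -
    have "(\<Sum>j<k. 2 ^ j * c) = (2 ^ k - 1) * c" for c :: real
      by (induction k) (simp_all add: algebra_simps)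
    then show ?thesis
      unfolding cum_weight_def unfolding l_def .
  qed
  \<comment> \<open>If R is not positive, log 2 R is a default value and the bound on K says
    nothing about R, but then the claim is trivial.\<close>
  have R: "R * 2 ^ 10 \<le> 2 ^ K"
  proof (cases "R > 0")
    case True
    then have "R * 2 ^ 10 = 2 powr (log 2 R + 10)"
      by (simp add: powr_add)
    also have "\<dots> \<le> 2 powr real K"
      using K by (intro powr_mono) auto
    finally show ?thesis
      by (simp add: powr_realpow)
  next
    case False
    then have "R * 2 ^ 10 \<le> 0"
      by simp
    then show ?thesis
      by (rule order_trans) simp
  qed
  have "l 0 * bregman r y0 ystar \<le> l 0 * B"
    using assms(6-8) by (intro mult_left_mono) (auto simp: l_def)
  then have first: "l 0 * bregman r y0 ystar \<le> \<epsilon> / 4"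
    using assms(6) by (simp add: l_def)
  have ratio: "l j / cum_weight j \<le> 2" if "j \<ge> 1" for j
  proof -
    have "(2::real) ^ 1 \<le> 2 ^ j"
      using that by (intro power_increasing) auto
    then show ?thesis
      using assms(6,8) unfolding cum by (simp add: l_def divide_simps)
  qed
  have "(\<Sum>j=1..<K. l j / cum_weight j * e j) \<le> (\<Sum>j=1..<K. 2 * e j)"
    using ratio assms(8) by (intro sum_mono mult_right_mono) (auto simp: e_def)
  also have "\<dots> \<le> \<epsilon> / 2"
    using K(2) assms(8) by (simp add: e_def of_nat_diff field_simps)
  finally have middle: "(\<Sum>j=1..<K. l j / cum_weight j * e j) \<le> \<epsilon> / 2" .
  have last: "L\<^sup>2 / (2 * (\<epsilon> / 8) * \<mu> * cum_weight K) * e K \<le> \<epsilon> / 8"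
  proof -
    have "(2::real) ^ 1 \<le> 2 ^ K"
      using K by (intro power_increasing) auto
    then have pow: "2 ^ K \<le> 2 * ((2::real) ^ K - 1)"
      by simp
    then have "32 * R \<le> 1 * (2 ^ K - 1)"
      using R by simp
    also have "\<dots> \<le> real K * (2 ^ K - 1)"
      using K pow by (intro mult_right_mono) auto
    finally have "32 * R / (real K * (2 ^ K - 1)) \<le> 1"
      using K pow by (simp add: divide_le_eq)
    then have "\<epsilon> / 8 * (32 * R / (real K * (2 ^ K - 1))) \<le> \<epsilon> / 8"
      using assms(8) by (intro mult_left_le) auto
    moreover have "L\<^sup>2 / (2 * (\<epsilon> / 8) * \<mu> * cum_weight K) * e K
        = \<epsilon> / 8 * (32 * R / (real K * (2 ^ K - 1)))"
      using assms(6,8) \<mu> K by (simp add: cum e_def R_def field_simps power2_eq_square)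
    ultimately show ?thesis
      by simp
  qed
  \<comment> \<open>Young parameter: of the budget epsilon / 4 left for the Lipschitz term, one half
    goes to eta and one half to the gap of the last round.\<close>
  have "integrable M (\<lambda>\<omega>. primal_min \<psi> X (y K \<omega>))"
    by (rule expected_suboptimality(1)[where v = ystar and L = L and \<eta> = "\<epsilon> / 8"])
      (use K(2) ystar assms(5,8) in auto)
  moreover have "primal_min \<psi> X ystar - expectation (\<lambda>\<omega>. primal_min \<psi> X (y K \<omega>))
      \<le> l 0 * bregman r y0 ystar + (\<Sum>j=1..<K. l j / cum_weight j * e j)
        + (\<epsilon> / 8 + L\<^sup>2 / (2 * (\<epsilon> / 8) * \<mu> * cum_weight K) * e K)"
    by (rule expected_suboptimality(2)) (use K(2) ystar assms(5,8) in auto)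
  ultimately show ?thesis
    using first middle last by linarith
qed

end
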